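(* Let $s\in(0,1]$ and $p\in[1,+\infty]$ be such that $sp>N$. Let $\widetilde s\in[0,1]$ and $\widetilde p\in[1,+\infty]$. If $\widetilde s$ and $\widetilde p$ do not satisfy $$\text{either}\quad\begin{cases}0\le\widetilde s\le\dfrac{sp-N}{p},\\ p\le\widetilde p\le+\infty,\end{cases}\qquad\text{or}\qquad\begin{cases}\dfrac{sp-N}{p}<\widetilde s\le s,\\ p\le\widetilde p\le\dfrac{Np}{N-(s-\widetilde s)p},\end{cases}$$ then the space $W^{s,p}(\mathbb{R}^N)$ is not continuously embedded in $W^{\widetilde s,\widetilde p}(\mathbb{R}^N)$.
   Context: $N\ge1$ is an integer and functions are real-valued and measurable. Let $\Omega$ be either $\mathbb{R}^N$ or an open bounded subset of $\mathbb{R}^N$ with Lipschitz boundary. For $s\in[0,1]$ and $p\in[1,+\infty)$ define $[u]_{W^{0,p}(\Omega)}:=\|u\|_{L^p(\Omega)}$, $[u]_{W^{1,p}(\Omega)}:=\|\nabla u\|_{L^p(\Omega)}$ (weak gradient) and, for $s\in(0,1)$, $$[u]_{W^{s,p}(\Omega)}:=\left(c_{N,s,p}\iint_{\Omega\times\Omega}\frac{|u(x)-u(y)|^p}{|x-y|^{N+sp}}\,dx\,dy\right)^{1/p},\qquad c_{N,s,p}:=\frac{s\,2^{2s-1}\,\Gamma\left(\frac{ps+p+N-2}{2}\right)}{\pi^{N/2}\,\Gamma(1-s)}.$$ Set $W^{s,p}(\Omega):=\{u\in L^p(\Omega):[u]_{W^{s,p}(\Omega)}<+\infty\}$, with norm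 $\|u\|_{W^{0,p}(\Omega)}:=\|u\|_{L^p(\Omega)}$ if $s=0$ and $\|u\|_{W^{s,p}(\Omega)}:=\big([u]^p_{W^{s,p}(\Omega)}+\|u\|^p_{L^p(\Omega)}\big)^{1/p}$ if $s\in(0,1]$. For $p=+\infty$: $W^{0,\infty}(\Omega):=L^\infty(\Omega)$ and, for $s\in(0,1]$, $W^{s,\infty}(\Omega):=C^{0,s}(\Omega)$ with norm $\|u\|_{L^\infty(\Omega)}+\sup_{x\neq y\in\Omega}\frac{|u(x)-u(y)|}{|x-y|^s}$ (functions being identified up to a.e. equality). Convention: $\frac{sp-N}{p}$ means $s-\frac Np$ with $\frac N\infty=0$ (so if $p=+\infty$ it equals $s$, the condition $sp>N$ holds, and the second alternative is empty). *)

theory Defs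
  imports "HOL-Analysis.Analysis" "HOL-Probability.Essential_Supremum"
begin

text \<open>
  The dimension N is DIM('a) for a type 'a of class euclidean_space, and the domain is a set
  \<Omega> :: 'a set (open in the intended use; the whole space is UNIV).  Functions are total functions
  of which only the values on \<Omega> matter, measurable with respect to Lebesgue measure on \<Omega>.
  (Semi)norms take values in ennreal, a function lying outside the space exactly when the value is
  top.  Exponents p in [1, \<infinity>] are extended reals.
\<close>

text \<open>Real powers on [0, \<infinity>] with top to the power a equal to top; used only for a > 0.\<close>

definition ennreal_pow :: "ennreal \<Rightarrow> real \<Rightarrow> ennreal" where
  "ennreal_pow x a = (if x = top then top else ennreal (enn2real x powr a))"

definition Lp_norm :: "'a::euclidean_space set \<Rightarrow> ereal \<Rightarrow> ('a \<Rightarrow> real) \<Rightarrow> ennreal" where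
  "Lp_norm \<Omega> p u =
     (if p = \<infinity> then esssup (lebesgue_on \<Omega>) (\<lambda>x. ennreal \<bar>u x\<bar>)
      else ennreal_pow (\<integral>\<^sup>+x. ennreal (\<bar>u x\<bar> powr real_of_ereal p) \<partial>lebesgue_on \<Omega>)
             (1 / real_of_ereal p))"

primrec Ck_fun :: "nat \<Rightarrow> ('a::euclidean_space \<Rightarrow> real) \<Rightarrow> bool" where
  "Ck_fun 0 f \<longleftrightarrow> continuous_on UNIV f"
| "Ck_fun (Suc k) f \<longleftrightarrow> (\<forall>x. f differentiable (at x)) \<and>
     (\<forall>e\<in>Basis. Ck_fun k (\<lambda>x. frechet_derivative f (at x) e))"

definition test_function :: "'a::euclidean_space set \<Rightarrow> ('a \<Rightarrow> real) \<Rightarrow> bool" where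
  "test_function \<Omega> \<phi> \<longleftrightarrow> (\<forall>k. Ck_fun k \<phi>) \<and>
     (\<exists>K. compact K \<and> K \<subseteq> \<Omega> \<and> (\<forall>x. x \<notin> K \<longrightarrow> \<phi> x = 0))"

definition locally_integrable ::
    "'a::euclidean_space set \<Rightarrow> ('a \<Rightarrow> 'b::{banach, second_countable_topology}) \<Rightarrow> bool" where
  "locally_integrable \<Omega> f \<longleftrightarrow> (\<forall>K. compact K \<and> K \<subseteq> \<Omega> \<longrightarrow> set_integrable lebesgue K f)"

definition is_weak_gradient ::
    "'a::euclidean_space set \<Rightarrow> ('a \<Rightarrow> real) \<Rightarrow> ('a \<Rightarrow> 'a) \<Rightarrow> bool" where
  "is_weak_gradient \<Omega> u g \<longleftrightarrow>
     u \<in> borel_measurable (lebesgue_on \<Omega>) \<and> g \<in> borel_measurable (lebesgue_on \<Omega>) \<and>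
     locally_integrable \<Omega> u \<and> locally_integrable \<Omega> g \<and>
     (\<forall>\<phi> e. test_function \<Omega> \<phi> \<longrightarrow> e \<in> Basis \<longrightarrow>
        (LINT x|lebesgue_on \<Omega>. u x * frechet_derivative \<phi> (at x) e) =
        - (LINT x|lebesgue_on \<Omega>. (g x \<bullet> e) * \<phi> x))"

text \<open>A weak gradient is unique up to null sets, so its \<open>L\<^sup>p\<close> norm does not depend on the choice.\<close>

definition weak_gradient :: "'a::euclidean_space set \<Rightarrow> ('a \<Rightarrow> real) \<Rightarrow> 'a \<Rightarrow> 'a" where
  "weak_gradient \<Omega> u = (SOME g. is_weak_gradient \<Omega> u g)"

definition gradient_seminorm ::
    "'a::euclidean_space set \<Rightarrow> ereal \<Rightarrow> ('a \<Rightarrow> real) \<Rightarrow> ennreal" where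
  "gradient_seminorm \<Omega> p u =
     (if \<exists>g. is_weak_gradient \<Omega> u g then Lp_norm \<Omega> p (\<lambda>x. norm (weak_gradient \<Omega> u x)) else top)"

definition gagliardo_const :: "nat \<Rightarrow> real \<Rightarrow> real \<Rightarrow> real" where
  "gagliardo_const N s p =
     s * 2 powr (2 * s - 1) * Gamma ((p * s + p + real N - 2) / 2) /
     (pi powr (real N / 2) * Gamma (1 - s))"

text \<open>The integrand is 0 on the diagonal, a null set, since \<open>0 / 0 = 0\<close>.\<close>

definition gagliardo_seminorm ::
    "'a::euclidean_space set \<Rightarrow> real \<Rightarrow> real \<Rightarrow> ('a \<Rightarrow> real) \<Rightarrow> ennreal" where
  "gagliardo_seminorm \<Omega> s p u =
     ennreal_pow
       (ennreal (gagliardo_const DIM('a) s p) *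
        (\<integral>\<^sup>+z. (case z of (x, y) \<Rightarrow>
             ennreal (\<bar>u x - u y\<bar> powr p / norm (x - y) powr (real DIM('a) + s * p)))
           \<partial>lebesgue_on (\<Omega> \<times> \<Omega>)))
       (1 / p)"

definition holder_quotient_sup ::
    "'a::euclidean_space set \<Rightarrow> real \<Rightarrow> ('a \<Rightarrow> real) \<Rightarrow> ennreal" where
  "holder_quotient_sup \<Omega> s v =
     (SUP (x, y)\<in>{(x, y). x \<in> \<Omega> \<and> y \<in> \<Omega> \<and> x \<noteq> y}. ennreal (\<bar>v x - v y\<bar> / norm (x - y) powr s))"

text \<open>
  Functions are identified up to a.e. equality, so a Hoelder function is one having a Hoelder
  representative.  On open \<Omega> two continuous representatives coincide; hence the infimum below is
  the Hoelder seminorm of that representative if there is one, and top otherwise.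
\<close>

definition holder_seminorm ::
    "'a::euclidean_space set \<Rightarrow> real \<Rightarrow> ('a \<Rightarrow> real) \<Rightarrow> ennreal" where
  "holder_seminorm \<Omega> s u =
     (INF v\<in>{v. AE x in lebesgue_on \<Omega>. v x = u x}. holder_quotient_sup \<Omega> s v)"

definition Wsp_seminorm ::
    "'a::euclidean_space set \<Rightarrow> real \<Rightarrow> ereal \<Rightarrow> ('a \<Rightarrow> real) \<Rightarrow> ennreal" where
  "Wsp_seminorm \<Omega> s p u =
     (if s = 0 then Lp_norm \<Omega> p u
      else if p = \<infinity> then holder_seminorm \<Omega> s u
      else if s = 1 then gradient_seminorm \<Omega> p u
      else gagliardo_seminorm \<Omega> s (real_of_ereal p) u)"

definition Wsp_norm ::
    "'a::euclidean_space set \<Rightarrow> real \<Rightarrow> ereal \<Rightarrow> ('a \<Rightarrow> real) \<Rightarrow> ennreal" where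
  "Wsp_norm \<Omega> s p u =
     (if s = 0 then Lp_norm \<Omega> p u
      else if p = \<infinity> then Lp_norm \<Omega> p u + Wsp_seminorm \<Omega> s p u
      else ennreal_pow
             (ennreal_pow (Wsp_seminorm \<Omega> s p u) (real_of_ereal p) +
              ennreal_pow (Lp_norm \<Omega> p u) (real_of_ereal p))
             (1 / real_of_ereal p))"

definition Wsp :: "'a::euclidean_space set \<Rightarrow> real \<Rightarrow> ereal \<Rightarrow> ('a \<Rightarrow> real) set" where
  "Wsp \<Omega> s p =
     {u \<in> borel_measurable (lebesgue_on \<Omega>). Lp_norm \<Omega> p u < top \<and> Wsp_seminorm \<Omega> s p u < top}"

definition Wsp_continuously_embedded ::
    "'a::euclidean_space set \<Rightarrow> real \<Rightarrow> ereal \<Rightarrow> real \<Rightarrow> ereal \<Rightarrow> bool" where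
  "Wsp_continuously_embedded \<Omega> s p s' p' \<longleftrightarrow>
     Wsp \<Omega> s p \<subseteq> Wsp \<Omega> s' p' \<and>
     (\<exists>C::real. \<forall>u \<in> Wsp \<Omega> s p. Wsp_norm \<Omega> s' p' u \<le> ennreal C * Wsp_norm \<Omega> s p u)"

end

theory Submission
  imports Defs
begin

text \<open>
  Since \<open>s' \<le> s\<close> follows from \<open>p \<le> p'\<close> and \<open>s' - N / p' \<le> s - N / p\<close>, the two alternatives together
  say exactly that these two inequalities hold.  If one of them fails, dilations
  \<open>u\<^sub>l(x) = u(x / l)\<close> of a single smooth bump function refute the embedding: the norm of \<open>u\<^sub>l\<close> in
  \<open>L\<^sup>p\<close> is of order \<open>l\<close> to the power \<open>N / p\<close>, its seminorm in \<open>W\<close> of order \<open>(s, p)\<close> is of order \<open>l\<close> to the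
  power \<open>N / p - s\<close>, so letting \<open>l\<close> tend to infinity excludes \<open>p' < p\<close>, and letting \<open>l\<close> tend to 0 excludes
  \<open>s' - N / p' > s - N / p\<close>.  For \<open>s = 1\<close> the seminorm involves an arbitrarily chosen weak gradient, which is
  identified with the classical one by uniqueness.
\<close>

section \<open>Smooth bump functions\<close>

text \<open>The source norm is a sum of two parts of different homogeneity, so each limit needs the
  part that dominates there: \<open>l powr (N / p)\<close> for large \<open>l\<close>,
  \<open>l powr (N / p - s)\<close> for small \<open>l\<close>. From the target only one part has to
  be bounded from below. The hypothesis s p > N makes the threshold s - N / p positive; hence s' - N
  / p' > s - N / p forces s' > 0, and the target norm then contains a seminorm scaling with exponent
  N / p' - s'. The work lies in the constants. The bump must have finite norm in the source, which
  for 0 < s < 1 means estimating the double integral by hand. For s = 1 uniqueness of weak gradients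
  needs enough test functions to detect a function almost everywhere, so the bumps must be smooth
  and approximate boxes. For a Hoelder target the infimum over a.e. equal functions must be bounded
  from below.\<close>

text \<open>The polynomial in \<open>1 / t\<close> makes the family closed under differentiation, so
  that smoothness follows by induction from a single derivative formula.\<close>

definition flat :: "real poly \<Rightarrow> real \<Rightarrow> real" where
  "flat P t = (if 0 < t then poly P (1 / t) * exp (- (1 / t)) else 0)"

lemma poly_exp_tendsto_0: "((\<lambda>y::real. poly P y * exp (- y)) \<longlongrightarrow> 0) at_top"
proof -
  have "((\<lambda>y::real. \<Sum>i\<le>degree P. coeff P i * (y ^ i / exp y)) \<longlongrightarrow> (\<Sum>i\<le>degree P. coeff P i * 0)) at_top"
    by (intro tendsto_intros tendsto_power_div_exp_0)
  then show ?thesis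
    by (simp add: poly_altdef sum_distrib_right exp_minus divide_inverse mult.assoc)
qed

lemma flat_tendsto_0: "(flat P \<longlongrightarrow> 0) (at 0)"
proof -
  have "((\<lambda>t::real. poly P (inverse t) * exp (- inverse t)) \<longlongrightarrow> 0) (at_right 0)"
    by (rule filterlim_compose[OF poly_exp_tendsto_0 filterlim_inverse_at_top_right])
  moreover have "\<forall>\<^sub>F t in at_right 0. poly P (inverse t) * exp (- inverse t) = flat P t"
    by (rule eventually_at_right_less[THEN eventually_mono])
       (auto simp: flat_def inverse_eq_divide)
  ultimately have "(flat P \<longlongrightarrow> 0) (at_right 0)"
    by (rule Lim_transform_eventually)
  moreover have "\<forall>\<^sub>F t in at_left 0. 0 = flat P t"
    by (rule eventually_at_leftI[of "-1"]) (auto simp: flat_def)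
  then have "(flat P \<longlongrightarrow> 0) (at_left 0)"
    by (rule Lim_transform_eventually[OF tendsto_const])
  ultimately show ?thesis
    by (simp add: filterlim_split_at)
qed

text \<open>With y = 1 / t, whose derivative is -y^2, the product rule for P(y) exp(-y) gives y^2
  (P(y) - P'(y)) exp(-y).\<close>

lemma has_field_derivative_flat:
  "(flat P has_field_derivative flat ([:0, 0, 1:] * (P - pderiv P)) t) (at t)"
proof -
  consider "t < 0" | "t > 0" | "t = 0" by linarith
  then show ?thesis
  proof cases
    case 1
    have "((\<lambda>_. 0) has_field_derivative 0) (at t)" by simp
    then have "(flat P has_field_derivative 0) (at t)"
      by (rule has_field_derivative_transform_within_open[where S="{..<0}"])
         (use 1 in \<open>auto simp: flat_def\<close>)
    then show ?thesis using 1 by (simp add: flat_def)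
  next
    case 2
    have inv: "((\<lambda>t. 1 / t) has_field_derivative - ((1 / t) ^ 2)) (at t)"
      using 2 by (auto intro!: derivative_eq_intros simp: power2_eq_square)
    have "((\<lambda>t. poly P (1 / t) * exp (- (1 / t))) has_field_derivative
        poly (pderiv P) (1 / t) * (- ((1 / t) ^ 2)) * exp (- (1 / t)) +
        exp (- (1 / t)) * (- (- ((1 / t) ^ 2))) * poly P (1 / t)) (at t)"
      by (rule DERIV_mult[OF DERIV_chain2[OF poly_DERIV inv]
            DERIV_chain2[OF DERIV_exp DERIV_minus[OF inv]]])
    also have "poly (pderiv P) (1 / t) * (- ((1 / t) ^ 2)) * exp (- (1 / t)) +
        exp (- (1 / t)) * (- (- ((1 / t) ^ 2))) * poly P (1 / t) =
        poly ([:0, 0, 1:] * (P - pderiv P)) (1 / t) * exp (- (1 / t))"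
      by (simp add: power2_eq_square ring_distribs)
    finally have "((\<lambda>t. poly P (1 / t) * exp (- (1 / t))) has_field_derivative
            poly ([:0, 0, 1:] * (P - pderiv P)) (1 / t) * exp (- (1 / t))) (at t)" .
    then have "(flat P has_field_derivative
            poly ([:0, 0, 1:] * (P - pderiv P)) (1 / t) * exp (- (1 / t))) (at t)"
      by (rule has_field_derivative_transform_within_open[where S="{0<..}"])
         (use 2 in \<open>auto simp: flat_def\<close>)
    then show ?thesis using 2 by (simp add: flat_def)
  next
    case 3
    \<comment> \<open>Dividing by the variable multiplies the polynomial by its indeterminate, so
      the difference quotient at 0 is again a \<open>flat\<close> function and tends to 0.\<close>
    have "\<forall>\<^sub>F y in at 0. flat ([:0, 1:] * P) y = (flat P y - flat P 0) / (y - 0)"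
      by (rule eventually_at_filter[THEN iffD2], rule always_eventually) (auto simp: flat_def)
    then have "((\<lambda>y. (flat P y - flat P 0) / (y - 0)) \<longlongrightarrow> 0) (at 0)"
      by (rule Lim_transform_eventually[OF flat_tendsto_0])
    then show ?thesis
      using 3 by (simp add: has_field_derivative_iff flat_def)
  qed
qed

section \<open>Closure properties of the classes of k times differentiable functions\<close>

lemma Ck_fun_SucD: "Ck_fun (Suc k) f \<Longrightarrow> Ck_fun k f"
proof (induction k arbitrary: f)
  case 0
  then show ?case
    by (simp add: differentiable_imp_continuous_on differentiable_on_def)
qed simp

lemma Ck_fun_const: "Ck_fun k (\<lambda>_. c)"
  by (induction k arbitrary: c) auto

lemma frechet_derivative_add_apply:
  assumes "f differentiable (at x)" "g differentiable (at x)"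
  shows "frechet_derivative (\<lambda>x. f x + g x) (at x) e =
    frechet_derivative f (at x) e + frechet_derivative g (at x) e"
  by (subst frechet_derivative_at[OF has_derivative_add[OF
          assms[THEN frechet_derivative_works[THEN iffD1]]], symmetric]) simp

lemma frechet_derivative_mult_apply:
  fixes f g :: "'a::real_normed_vector \<Rightarrow> real"
  assumes "f differentiable (at x)" "g differentiable (at x)"
  shows "frechet_derivative (\<lambda>x. f x * g x) (at x) e =
    f x * frechet_derivative g (at x) e + frechet_derivative f (at x) e * g x"
  by (subst frechet_derivative_at[OF has_derivative_mult[OF
          assms[THEN frechet_derivative_works[THEN iffD1]]], symmetric]) simp

lemma Ck_fun_add: "Ck_fun k f \<Longrightarrow> Ck_fun k g \<Longrightarrow> Ck_fun k (\<lambda>x. f x + g x)"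
proof (induction k arbitrary: f g)
  case 0
  then show ?case by (auto intro: continuous_intros)
qed (auto simp: frechet_derivative_add_apply)

lemma Ck_fun_mult: "Ck_fun k f \<Longrightarrow> Ck_fun k g \<Longrightarrow> Ck_fun k (\<lambda>x. f x * g x)"
proof (induction k arbitrary: f g)
  case 0
  then show ?case by (auto intro: continuous_intros)
next
  case (Suc k)
  \<comment> \<open>The product rule leaves one factor undifferentiated, so the factors are needed
    in class \<open>k\<close> besides their derivatives.\<close>
  then have "Ck_fun k f" "Ck_fun k g" by (auto dest: Ck_fun_SucD simp del: Ck_fun.simps)
  with Suc show ?case
    by (auto simp: frechet_derivative_mult_apply intro!: Ck_fun_add)
qed

lemma Ck_fun_prod:
  "finite I \<Longrightarrow> (\<And>i. i \<in> I \<Longrightarrow> Ck_fun k (f i)) \<Longrightarrow> Ck_fun k (\<lambda>x. \<Prod>i\<in>I. f i x)"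
  by (induction I rule: finite_induct) (auto intro: Ck_fun_const Ck_fun_mult)

lemma Ck_fun_flat: "Ck_fun k (\<lambda>x. flat P (x \<bullet> b + a))"
proof (induction k arbitrary: P)
  case 0
  have "continuous_on UNIV (flat P)"
    by (intro continuous_at_imp_continuous_on ballI DERIV_isCont[OF has_field_derivative_flat])
  then have "continuous_on UNIV (\<lambda>x. flat P (x \<bullet> b + a))"
    by (rule continuous_on_compose2) (auto intro!: continuous_intros)
  then show ?case by simp
next
  case (Suc k)
  have D: "((\<lambda>x. flat P (x \<bullet> b + a)) has_derivative
      (\<lambda>h. flat ([:0, 0, 1:] * (P - pderiv P)) (x \<bullet> b + a) * (h \<bullet> b))) (at x)" for x
  proof -
    have "((\<lambda>x. x \<bullet> b + a) has_derivative (\<lambda>h. h \<bullet> b)) (at x)"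
      by (auto intro!: derivative_eq_intros)
    then show ?thesis
      by (rule has_derivative_compose[OF _ has_field_derivative_flat[unfolded has_field_derivative_def]])
  qed
  \<comment> \<open>The constant \<open>e \<bullet> b\<close> is absorbed into the polynomial, so
    that the induction hypothesis, which holds for every polynomial, applies.\<close>
  have "frechet_derivative (\<lambda>x. flat P (x \<bullet> b + a)) (at x) e =
      flat (smult (e \<bullet> b) ([:0, 0, 1:] * (P - pderiv P))) (x \<bullet> b + a)" for x e
    by (subst frechet_derivative_at[OF D, symmetric]) (auto simp: flat_def)
  then show ?case
    using Suc differentiableI[OF D] by (simp del: mult_pCons_left)
qed

text \<open>Since the n-th root of \<open>exp (- 1 / t)\<close> is \<open>exp (- 1 / (n * t))\<close>, these functions increase to
  the indicator function of the box as \<open>n\<close> tends to infinity.\<close>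

definition box_bump :: "'a::euclidean_space \<Rightarrow> 'a \<Rightarrow> real \<Rightarrow> 'a \<Rightarrow> real" where
  "box_bump a c n x = (\<Prod>b\<in>Basis. flat 1 (n * ((x - a) \<bullet> b)) * flat 1 (n * ((c - x) \<bullet> b)))"

lemma flat_1_bounds: "0 \<le> flat 1 t" "flat 1 t \<le> 1"
  by (auto simp: flat_def)

lemma box_bump_bounds: "0 \<le> box_bump a c n x" "box_bump a c n x \<le> 1"
  unfolding box_bump_def
  by (intro prod_nonneg ballI prod_le_1 conjI mult_nonneg_nonneg mult_le_one flat_1_bounds)+

lemma box_bump_eq_0: "0 < n \<Longrightarrow> x \<notin> box a c \<Longrightarrow> box_bump a c n x = 0"
  unfolding box_bump_def
  by (rule prod_zero) (force simp: mem_box flat_def inner_diff_left zero_less_mult_iff not_less)+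

lemma box_bump_pos: "0 < n \<Longrightarrow> x \<in> box a c \<Longrightarrow> 0 < box_bump a c n x"
  by (auto simp: box_bump_def mem_box flat_def inner_diff_left intro!: prod_pos)

lemma test_function_box_bump:
  assumes "0 < n"
  shows "test_function UNIV (box_bump a c n)"
proof -
  have "Ck_fun k (\<lambda>x. flat 1 (x \<bullet> (n *\<^sub>R b) + (- n * (a \<bullet> b))) *
      flat 1 (x \<bullet> (- n *\<^sub>R b) + n * (c \<bullet> b)))" for k b
    by (intro Ck_fun_mult Ck_fun_flat)
  then have "Ck_fun k (box_bump a c n)" for k
    unfolding box_bump_def
    by (intro Ck_fun_prod finite_Basis) (simp add: inner_diff_left right_diff_distrib)
  moreover have "x \<notin> cbox a c \<Longrightarrow> box_bump a c n x = 0" for x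
    using box_bump_eq_0[OF assms] box_subset_cbox by blast
  ultimately show ?thesis
    unfolding test_function_def using compact_cbox by blast
qed

lemma box_bump_tendsto_indicator:
  "(\<lambda>n. box_bump a c (real (Suc n)) x) \<longlonglongrightarrow> indicator (box a c) x"
proof (cases "x \<in> box a c")
  case True
  have flat: "(\<lambda>n. flat 1 (real (Suc n) * t)) \<longlonglongrightarrow> 1" if "0 < t" for t
  proof -
    have "(\<lambda>n. exp (- (1 / t * inverse (real (Suc n))))) \<longlonglongrightarrow> exp (- (1 / t * 0))"
      by (intro tendsto_intros LIMSEQ_inverse_real_of_nat)
    then show ?thesis
      using that by (simp add: flat_def inverse_eq_divide mult.commute)
  qed
  have "(\<lambda>n. box_bump a c (real (Suc n)) x) \<longlonglongrightarrow> (\<Prod>b\<in>(Basis::'a set). 1 * 1)"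
    unfolding box_bump_def using True
    by (intro tendsto_prod tendsto_mult flat) (auto simp: mem_box inner_diff_left)
  then show ?thesis using True by simp
qed (simp add: box_bump_eq_0)

section \<open>Integration against test functions\<close>

text \<open>Fundamental lemma of the calculus of variations. Bumps converge to indicators of boxes,
  so \<open>h\<close> has integral 0 over every box, and Lebesgue differentiation recovers
  \<open>h\<close> from these integrals.\<close>

lemma AE_eq_0_if_test_integrals_0:
  fixes h :: "'a::euclidean_space \<Rightarrow> real"
  assumes h: "locally_integrable UNIV h"
    and test: "\<And>\<phi>. test_function UNIV \<phi> \<Longrightarrow> (LINT x|lebesgue. h x * \<phi> x) = 0"
  shows "AE x in lebesgue. h x = 0"
proof -
  have int: "set_integrable lebesgue (cbox a c) h" for a c
    using h by (simp add: locally_integrable_def)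
  have box: "integral (cbox a c) h = 0" for a c
  proof -
    \<comment> \<open>As \<open>h\<close> is only locally integrable, it is cut off to the closed
      box, outside of which the bumps vanish; \<open>\<bar>?g\<bar>\<close> then dominates because
      bumps are at most 1.\<close>
    let ?g = "\<lambda>x. indicator (cbox a c) x * h x"
    have g: "integrable lebesgue ?g"
      using int[of a c] by (simp add: set_integrable_def)
    have eq: "h x * box_bump a c (real (Suc n)) x = ?g x * box_bump a c (real (Suc n)) x" for n x
      using box_bump_eq_0[of "real (Suc n)" x a c] box_subset_cbox[of a c]
      by (auto simp: indicator_def)
    have cont: "continuous_on UNIV (box_bump a c (real (Suc n)))" for n
      using test_function_box_bump[of "real (Suc n)" a c]
      by (auto simp: test_function_def dest!: spec[of _ 0])
    have meas: "box_bump a c (real (Suc n)) \<in> borel_measurable lebesgue" for n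
      by (rule measurable_completion) (simp add: borel_measurable_continuous_onI cont del: of_nat_Suc)
    have "(\<lambda>n. LINT x|lebesgue. ?g x * box_bump a c (real (Suc n)) x) \<longlonglongrightarrow>
        (LINT x|lebesgue. ?g x * indicator (box a c) x)"
    proof (rule integral_dominated_convergence[where w="\<lambda>x. norm (?g x)"])
      show "AE x in lebesgue. norm (?g x * box_bump a c (real (Suc n)) x) \<le> norm (?g x)" for n
        by (intro AE_I2) (auto simp: abs_mult box_bump_bounds intro!: mult_left_le)
      show "(\<lambda>x. ?g x * box_bump a c (real (Suc n)) x) \<in> borel_measurable lebesgue" for n
        by (rule borel_measurable_times[OF borel_measurable_integrable[OF g] meas])
      show "(\<lambda>x. ?g x * indicator (box a c) x) \<in> borel_measurable lebesgue"
        by (rule borel_measurable_times[OF borel_measurable_integrable[OF g] borel_measurable_indicator]) simp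
    qed (use g in \<open>auto intro!: AE_I2 tendsto_intros box_bump_tendsto_indicator simp del: of_nat_Suc\<close>)
    moreover have "(LINT x|lebesgue. ?g x * box_bump a c (real (Suc n)) x) = 0" for n
      using test[OF test_function_box_bump[of "real (Suc n)" a c]] by (simp only: eq of_nat_0_less_iff zero_less_Suc)
    ultimately have "(LINT x|lebesgue. ?g x * indicator (box a c) x) = 0"
      by (simp add: LIMSEQ_const_iff)
    moreover have "?g x * indicator (box a c) x = indicator (box a c) x *\<^sub>R h x" for x
      using box_subset_cbox[of a c] by (auto simp: indicator_def)
    ultimately have "(LINT x:box a c|lebesgue. h x) = 0"
      by (simp add: set_lebesgue_integral_def)
    moreover have "set_integrable lebesgue (box a c) h"
      by (rule set_integrable_subset[OF int _ box_subset_cbox]) simp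
    ultimately have "integral (box a c) h = 0"
      using set_lebesgue_integral_eq_integral(2) by metis
    then show ?thesis by (simp add: integral_open_interval)
  qed
  have "h integrable_on cbox a c" for a c
    by (rule set_lebesgue_integral_eq_integral[OF int])
  \<comment> \<open>Lebesgue differentiation: for almost every \<open>x\<close>, the means of
    \<open>h\<close> over small cubes with lower corner \<open>x\<close> tend to
    \<open>h x\<close>.\<close>
  from integrable_ccontinuous_explicit[OF this]
  obtain N where N: "negligible N" and lim: "\<And>x e. \<lbrakk>x \<notin> N; 0 < e\<rbrakk> \<Longrightarrow>
      \<exists>d>0. \<forall>t. 0 < t \<and> t < d \<longrightarrow>
        norm (integral (cbox x (x + t *\<^sub>R One)) h /\<^sub>R t ^ DIM('a) - h x) < e"
    by metis
  have "h x = 0" if x: "x \<notin> N" for x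
  proof (rule ccontr)
    assume "h x \<noteq> 0"
    then obtain d where "d > 0" and d: "\<And>t. 0 < t \<Longrightarrow> t < d \<Longrightarrow>
        norm (integral (cbox x (x + t *\<^sub>R One)) h /\<^sub>R t ^ DIM('a) - h x) < \<bar>h x\<bar>"
      using lim[OF x, of "\<bar>h x\<bar>"] by auto
    from d[of "d / 2"] \<open>d > 0\<close> show False by (simp add: box)
  qed
  moreover have "N \<in> null_sets lebesgue" using N by (simp add: negligible_iff_null_sets)
  ultimately show ?thesis by (intro AE_I'[of N]) auto
qed

section \<open>Compactly supported functions and integrals of their derivatives\<close>

lemma integrable_compact_support:
  fixes f :: "'a::euclidean_space \<Rightarrow> 'b::{banach, second_countable_topology}"
  assumes "compact K" "continuous_on UNIV f" "\<And>x. x \<notin> K \<Longrightarrow> f x = 0"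
  shows "integrable lborel f"
proof -
  have "integrable lborel (\<lambda>x. indicator K x *\<^sub>R f x)"
    by (rule borel_integrable_compact) (use assms continuous_on_subset in blast)+
  also have "(\<lambda>x. indicator K x *\<^sub>R f x) = f"
    using assms(3) by (auto simp: indicator_def)
  finally show ?thesis .
qed

lemma has_derivative_0_outside_support:
  assumes "compact K" "\<And>x. x \<notin> K \<Longrightarrow> f x = 0" "(f has_derivative f') (at x)" "x \<notin> K"
  shows "f' = (\<lambda>_. 0)"
proof -
  have "(f has_derivative (\<lambda>_. 0)) (at x)"
    by (rule has_derivative_transform_within_open[of "\<lambda>_. 0" _ _ _ "- K"])
       (use assms compact_imp_closed in auto)
  then show ?thesis using assms(3) has_derivative_unique by blast
qed

lemma bounded_compact_support:
  fixes f :: "'a::euclidean_space \<Rightarrow> 'b::real_normed_vector"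
  assumes "compact K" "continuous_on UNIV f" "\<And>x. x \<notin> K \<Longrightarrow> f x = 0"
  obtains B where "0 < B" "\<And>x. norm (f x) \<le> B"
proof -
  have "bounded (f ` K)"
    using assms by (intro compact_imp_bounded compact_continuous_image) (auto intro: continuous_on_subset)
  then obtain B where "0 < B" and B: "\<And>y. y \<in> f ` K \<Longrightarrow> norm y \<le> B"
    by (auto simp: bounded_pos)
  have "norm (f x) \<le> B" for x
    using \<open>0 < B\<close> B[of "f x"] assms(3)[of x] by (cases "x \<in> K") auto
  with \<open>0 < B\<close> show thesis by (rule that)
qed

lemma integral_lborel_translation:
  fixes f :: "'a::euclidean_space \<Rightarrow> 'b::{banach, second_countable_topology}"
  assumes [measurable]: "f \<in> borel_measurable borel"
  shows "(LINT x|lborel. f (a + x)) = (LINT x|lborel. f x)"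
proof -
  have "(LINT x|lborel. f x) = (LINT x|distr lborel borel ((+) a). f x)"
    by (simp add: lborel_distr_plus)
  also have "\<dots> = (LINT x|lborel. f (a + x))"
    by (rule integral_distr) simp_all
  finally show ?thesis by simp
qed

text \<open>By translation invariance all difference quotients have integral 0; pass to the limit.\<close>

lemma integral_directional_derivative_eq_0:
  fixes f :: "'a::euclidean_space \<Rightarrow> real"
  assumes D: "\<And>x. (f has_derivative f' x) (at x)"
    and cont: "continuous_on UNIV (\<lambda>x. f' x e)"
    and K: "compact K" "\<And>x. x \<notin> K \<Longrightarrow> f x = 0"
  shows "(LINT x|lborel. f' x e) = 0"
proof -
  have f'0: "f' x e = 0" if "x \<notin> K" for x
    using has_derivative_0_outside_support[OF K D that] by simp
  obtain B where "0 < B" and B: "\<And>x. norm (f' x e) \<le> B"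
    using bounded_compact_support[OF K(1) cont f'0] by metis
  obtain R where R: "\<And>x. x \<in> K \<Longrightarrow> norm x \<le> R"
    using compact_imp_bounded[OF K(1)] by (auto simp: bounded_iff)
  have contf: "continuous_on UNIV f"
    using D by (intro differentiable_imp_continuous_on) (auto simp: differentiable_on_def differentiable_def)
  then have [measurable]: "f \<in> borel_measurable borel"
    by (rule borel_measurable_continuous_onI)
  define t where "t n = inverse (real (Suc n))" for n
  have t: "0 < t n" "t n \<le> 1" for n
    by (auto simp: t_def field_simps)
  define q where "q n x = (f (t n *\<^sub>R e + x) - f x) / t n" for n x
  have line: "((\<lambda>r. f (r *\<^sub>R e + x)) has_real_derivative f' (r *\<^sub>R e + x) e) (at r)" for r x
  proof -
    have "((\<lambda>r. r *\<^sub>R e + x) has_derivative (\<lambda>h. h *\<^sub>R e)) (at r)"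
      by (auto intro!: derivative_eq_intros)
    from has_derivative_compose[OF this D] show ?thesis
      by (simp add: has_field_derivative_def linear_scale[OF has_derivative_linear[OF D]]
          mult_commute_abs)
  qed
  \<comment> \<open>By the mean value theorem a difference quotient is a directional derivative at
    an intermediate point.\<close>
  have bound: "norm (q n x) \<le> B" for n x
  proof -
    obtain r where "f (t n *\<^sub>R e + x) - f (0 *\<^sub>R e + x) = (t n - 0) * f' (r *\<^sub>R e + x) e"
      using MVT2[of 0 "t n" "\<lambda>r. f (r *\<^sub>R e + x)" "\<lambda>r. f' (r *\<^sub>R e + x) e"] t line by metis
    then have "q n x = f' (r *\<^sub>R e + x) e"
      using t[of n] by (simp add: q_def)
    then show ?thesis using B by simp
  qed
  \<comment> \<open>Since \<open>t n \<le> 1\<close>, the shift moves points by at most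
    \<open>norm e\<close>, so one enlarged ball contains the supports of all quotients and carries
    the integrable majorant.\<close>
  have supp: "q n x = 0" if "x \<notin> cball 0 (R + norm e)" for n x
  proof -
    have "norm x \<le> norm (t n *\<^sub>R e + x) + norm (t n *\<^sub>R e)"
      by (metis add_diff_cancel_left' norm_triangle_ineq4 add.commute)
    also have "norm (t n *\<^sub>R e) \<le> norm e"
      using t[of n] by (simp add: mult_left_le_one_le)
    finally have "norm x \<le> norm (t n *\<^sub>R e + x) + norm e" by simp
    with that have "R < norm (t n *\<^sub>R e + x)" by simp
    moreover have "R < norm x" using that norm_ge_zero[of e] unfolding mem_cball_0 by linarith
    ultimately have "t n *\<^sub>R e + x \<notin> K" "x \<notin> K"
      using R not_less by blast+
    then show ?thesis using K by (simp add: q_def)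
  qed
  have "(\<lambda>n. LINT x|lborel. q n x) \<longlonglongrightarrow> (LINT x|lborel. f' x e)"
  proof (rule integral_dominated_convergence[where w="\<lambda>x. indicator (cball 0 (R + norm e)) x * B"])
    show "AE x in lborel. (\<lambda>n. q n x) \<longlonglongrightarrow> f' x e"
    proof (rule AE_I2)
      fix x
      have "((\<lambda>r. (f (r *\<^sub>R e + x) - f (0 *\<^sub>R e + x)) / (r - 0)) \<longlongrightarrow> f' (0 *\<^sub>R e + x) e) (at 0)"
        using line[of x 0] by (simp add: has_field_derivative_iff)
      moreover have "t \<longlonglongrightarrow> 0"
        unfolding t_def[abs_def] by (rule LIMSEQ_inverse_real_of_nat)
      then have "filterlim t (at 0) sequentially"
        using t(1) by (simp add: filterlim_at less_imp_neq[THEN not_sym])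
      ultimately show "(\<lambda>n. q n x) \<longlonglongrightarrow> f' x e"
        by (drule_tac filterlim_compose) (auto simp: q_def)
    qed
    show "AE x in lborel. norm (q n x) \<le> indicator (cball 0 (R + norm e)) x * B" for n
      using bound[of n] supp[of _ n] by (intro AE_I2) (auto simp: indicator_def)
    show "integrable lborel (\<lambda>x. indicator (cball 0 (R + norm e)) x * B)"
      by (intro integrable_mult_left integrable_real_indicator)
         (use emeasure_lborel_cball_finite in \<open>auto simp: top_unique\<close>)
    show "(\<lambda>x. f' x e) \<in> borel_measurable lborel"
      using cont by (simp add: borel_measurable_continuous_onI)
    show "q n \<in> borel_measurable lborel" for n
      unfolding q_def by measurable
  qed
  moreover have "(LINT x|lborel. q n x) = 0" for n
  proof -
    have "integrable lborel f"
      by (rule integrable_compact_support[OF K(1) contf K(2)])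
    moreover from this have "integrable lborel (\<lambda>x. f (t n *\<^sub>R e + x))"
      using integrable_distr[of "(+) (t n *\<^sub>R e)" lborel borel f]
      by (simp add: lborel_distr_plus)
    ultimately show ?thesis
      by (simp add: q_def integral_lborel_translation)
  qed
  ultimately show ?thesis by (simp add: LIMSEQ_const_iff)
qed

section \<open>Weak gradients of compactly supported continuously differentiable functions\<close>

text \<open>Carrying the gradient as an explicit field \<open>G\<close> turns the chain rule under
  dilation into a formula for the new field.\<close>

definition C1c_with_gradient :: "('a::euclidean_space \<Rightarrow> real) \<Rightarrow> ('a \<Rightarrow> 'a) \<Rightarrow> bool" where
  "C1c_with_gradient u G \<longleftrightarrow>
     (\<forall>x. (u has_derivative (\<lambda>h. G x \<bullet> h)) (at x)) \<and> continuous_on UNIV G \<and>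
     (\<exists>K. compact K \<and> (\<forall>x. x \<notin> K \<longrightarrow> u x = 0))"

lemma C1c_with_gradient_ex_support:
  assumes "C1c_with_gradient u G"
  obtains K where "compact K" "\<And>x. x \<notin> K \<Longrightarrow> u x = 0" "\<And>x. x \<notin> K \<Longrightarrow> G x = 0"
proof -
  from assms obtain K where K: "compact K" "\<And>x. x \<notin> K \<Longrightarrow> u x = 0"
    and D: "\<And>x. (u has_derivative (\<lambda>h. G x \<bullet> h)) (at x)"
    by (auto simp: C1c_with_gradient_def)
  have "G x = 0" if "x \<notin> K" for x
  proof -
    \<comment> \<open>The derivative vanishes in every direction, in particular in the direction
      \<open>G x\<close>.\<close>
    have "G x \<bullet> G x = 0"
      using has_derivative_0_outside_support[OF K D that] by meson
    then show ?thesis by simp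
  qed
  with K show thesis by (rule that)
qed

lemma C1c_with_gradient_continuous:
  assumes "C1c_with_gradient u G"
  shows "continuous_on UNIV u" "continuous_on UNIV G"
  using assms has_derivative_continuous_on[of UNIV u "\<lambda>x h. G x \<bullet> h"] by (auto simp: C1c_with_gradient_def)

lemma C1c_with_gradient_lipschitz:
  assumes "C1c_with_gradient u G"
  obtains L where "0 < L" "\<And>x y. \<bar>u x - u y\<bar> \<le> L * norm (x - y)"
proof -
  obtain K where K: "compact K" "\<And>x. x \<notin> K \<Longrightarrow> u x = 0" "\<And>x. x \<notin> K \<Longrightarrow> G x = 0"
    using C1c_with_gradient_ex_support[OF assms] by metis
  obtain L where "0 < L" and L: "\<And>x. norm (G x) \<le> L"
    using bounded_compact_support[OF K(1) C1c_with_gradient_continuous(2)[OF assms] K(3)] by metis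
  have "norm (u x - u y) \<le> L * norm (x - y)" for x y
  proof (rule differentiable_bound[OF convex_UNIV, where f'="\<lambda>x h. G x \<bullet> h"])
    show "(u has_derivative (\<lambda>h. G x \<bullet> h)) (at x within UNIV)" for x
      using assms by (auto simp: C1c_with_gradient_def)
    show "onorm (\<lambda>h. G x \<bullet> h) \<le> L" for x
    proof (rule onorm_le)
      fix h
      have "norm (G x \<bullet> h) \<le> norm (G x) * norm h"
        using Cauchy_Schwarz_ineq2[of "G x" h] by simp
      also have "\<dots> \<le> L * norm h" by (intro mult_right_mono L) simp
      finally show "norm (G x \<bullet> h) \<le> L * norm h" .
    qed
  qed auto
  with \<open>0 < L\<close> show thesis by (intro that) auto
qed

lemma C1c_with_gradient_scale:
  assumes "C1c_with_gradient u G" "0 < l"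
  shows "C1c_with_gradient (\<lambda>x. u (x /\<^sub>R l)) (\<lambda>x. G (x /\<^sub>R l) /\<^sub>R l)"
proof -
  have "((\<lambda>x. u (x /\<^sub>R l)) has_derivative (\<lambda>h. (G (x /\<^sub>R l) /\<^sub>R l) \<bullet> h)) (at x)" for x
  proof -
    have "((\<lambda>x. x /\<^sub>R l) has_derivative (\<lambda>h. h /\<^sub>R l)) (at x)"
      by (auto intro!: derivative_eq_intros)
    moreover have "(u has_derivative (\<lambda>h. G (x /\<^sub>R l) \<bullet> h)) (at (x /\<^sub>R l))"
      using assms by (simp add: C1c_with_gradient_def)
    ultimately show ?thesis
      by (auto dest: has_derivative_compose)
  qed
  moreover have "continuous_on UNIV (\<lambda>x. G (x /\<^sub>R l) /\<^sub>R l)"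
    by (intro continuous_intros continuous_on_compose2[OF C1c_with_gradient_continuous(2)[OF assms(1)]]) auto
  moreover have "\<exists>K. compact K \<and> (\<forall>x. x \<notin> K \<longrightarrow> u (x /\<^sub>R l) = 0)"
  proof -
    obtain K where K: "compact K" "\<And>x. x \<notin> K \<Longrightarrow> u x = 0"
      using assms by (auto simp: C1c_with_gradient_def)
    have "u (x /\<^sub>R l) = 0" if "x \<notin> (\<lambda>y. l *\<^sub>R y) ` K" for x
    proof -
      have "x = l *\<^sub>R (x /\<^sub>R l)" using assms(2) by simp
      then show ?thesis using that K(2) by blast
    qed
    then show ?thesis using compact_scaling[OF K(1)] by blast
  qed
  ultimately show ?thesis by (simp add: C1c_with_gradient_def)
qed

text \<open>\<open>Ck_fun\<close> speaks of partial derivatives along the basis only; the gradient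
  is assembled from them, and linearity of the derivative covers all directions.\<close>

lemma test_function_imp_C1c:
  assumes "test_function UNIV u"
  shows "C1c_with_gradient u (\<lambda>x. \<Sum>b\<in>Basis. frechet_derivative u (at x) b *\<^sub>R b)"
proof -
  have "Ck_fun 1 u" using assms by (simp add: test_function_def)
  then have diff: "u differentiable (at x)"
    and cont: "b \<in> Basis \<Longrightarrow> continuous_on UNIV (\<lambda>x. frechet_derivative u (at x) b)" for x b
    by auto
  have "(u has_derivative (\<lambda>h. (\<Sum>b\<in>Basis. frechet_derivative u (at x) b *\<^sub>R b) \<bullet> h)) (at x)" for x
  proof -
    have lin: "linear (frechet_derivative u (at x))"
      using diff by (rule linear_frechet_derivative)
    have "(\<Sum>b\<in>Basis. frechet_derivative u (at x) b *\<^sub>R b) \<bullet> h = frechet_derivative u (at x) h" for h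
    proof -
      have "frechet_derivative u (at x) h = frechet_derivative u (at x) (\<Sum>b\<in>Basis. (h \<bullet> b) *\<^sub>R b)"
        by (simp add: euclidean_representation)
      also have "\<dots> = (\<Sum>b\<in>Basis. (h \<bullet> b) * frechet_derivative u (at x) b)"
        by (simp add: linear_sum[OF lin] linear_scale[OF lin])
      finally show ?thesis
        by (simp add: inner_sum_left) (simp add: inner_commute mult.commute)
    qed
    then show ?thesis
      using diff by (simp add: frechet_derivative_works)
  qed
  then show ?thesis
    using assms by (auto simp: C1c_with_gradient_def test_function_def intro!: continuous_intros cont)
qed

lemma continuous_imp_locally_integrable:
  fixes f :: "'a::euclidean_space \<Rightarrow> 'b::{banach, second_countable_topology}"
  assumes "continuous_on UNIV f"
  shows "locally_integrable UNIV f"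
  unfolding locally_integrable_def set_integrable_def
proof (intro allI impI)
  fix K :: "'a set" assume "compact K \<and> K \<subseteq> UNIV"
  then have "integrable lborel (\<lambda>x. indicator K x *\<^sub>R f x)"
    by (intro borel_integrable_compact continuous_on_subset[OF assms]) auto
  then show "integrable lebesgue (\<lambda>x. indicator K x *\<^sub>R f x)"
    using integrable_completion borel_measurable_integrable by blast
qed

text \<open>Integration by parts: the product of \<open>u\<close> with a test function has compact
  support, so its directional derivative has integral 0, and the product rule splits this
  integral.\<close>

lemma C1c_is_weak_gradient:
  assumes u: "C1c_with_gradient u G"
  shows "is_weak_gradient UNIV u G"
proof -
  have cont: "continuous_on UNIV u" "continuous_on UNIV G"
    by (rule C1c_with_gradient_continuous[OF u])+
  have "(LINT x|lebesgue. u x * frechet_derivative \<phi> (at x) e) = - (LINT x|lebesgue. (G x \<bullet> e) * \<phi> x)"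
    if \<phi>: "test_function UNIV \<phi>" and e: "e \<in> Basis" for \<phi> e
  proof -
    define D where "D x = (\<Sum>b\<in>Basis. frechet_derivative \<phi> (at x) b *\<^sub>R b)" for x
    have C: "C1c_with_gradient \<phi> D"
      using test_function_imp_C1c[OF \<phi>] by (simp add: D_def[abs_def])
    have cont': "continuous_on UNIV \<phi>" "continuous_on UNIV D"
      by (rule C1c_with_gradient_continuous[OF C])+
    obtain K where K: "compact K" "\<And>x. x \<notin> K \<Longrightarrow> \<phi> x = 0" "\<And>x. x \<notin> K \<Longrightarrow> D x = 0"
      using C1c_with_gradient_ex_support[OF C] by metis
    have "frechet_derivative \<phi> (at x) e = D x \<bullet> e" for x
      using C frechet_derivative_at[of \<phi> "(\<bullet>) (D x)" x] by (simp add: C1c_with_gradient_def fun_eq_iff)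
    moreover have "(LINT x|lborel. u x * (D x \<bullet> e) + (G x \<bullet> e) * \<phi> x) = 0"
    proof (rule integral_directional_derivative_eq_0[where
          f'="\<lambda>x h. u x * (D x \<bullet> h) + (G x \<bullet> h) * \<phi> x" and f="\<lambda>x. u x * \<phi> x"])
      show "((\<lambda>x. u x * \<phi> x) has_derivative (\<lambda>h. u x * (D x \<bullet> h) + (G x \<bullet> h) * \<phi> x)) (at x)" for x
        using u C by (intro has_derivative_mult) (auto simp: C1c_with_gradient_def)
    qed (use K cont cont' in \<open>auto intro!: continuous_intros\<close>)
    moreover have int: "integrable lborel (\<lambda>x. u x * (D x \<bullet> e))" "integrable lborel (\<lambda>x. (G x \<bullet> e) * \<phi> x)"
      by (rule integrable_compact_support[OF K(1)];
          use K cont cont' in \<open>auto intro!: continuous_intros\<close>)+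
    moreover note integral_completion[OF borel_measurable_integrable[OF int(1)]]
      integral_completion[OF borel_measurable_integrable[OF int(2)]]
    ultimately show ?thesis by simp
  qed
  moreover have "u \<in> borel_measurable lebesgue" "G \<in> borel_measurable lebesgue"
    using cont by (auto intro!: measurable_completion borel_measurable_continuous_onI)
  ultimately show ?thesis
    using cont by (simp add: is_weak_gradient_def lebesgue_on_UNIV_eq continuous_imp_locally_integrable)
qed

section \<open>Uniqueness of weak gradients\<close>

lemma locally_integrable_inner_left:
  fixes g :: "'a::euclidean_space \<Rightarrow> 'b::euclidean_space"
  shows "locally_integrable S g \<Longrightarrow> locally_integrable S (\<lambda>x. g x \<bullet> e)"
  unfolding locally_integrable_def set_integrable_def
  by (auto dest!: spec integrable_inner_left[of e] simp flip: inner_scaleR_left)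

text \<open>A test function is bounded and lives on a compact set, where \<open>h\<close> is
  integrable.\<close>

lemma integrable_times_test_function:
  assumes h: "locally_integrable UNIV h" and \<phi>: "test_function UNIV \<phi>"
  shows "integrable lebesgue (\<lambda>x. h x * \<phi> x)"
proof -
  obtain K where K: "compact K" "\<And>x. x \<notin> K \<Longrightarrow> \<phi> x = 0"
    using \<phi> by (auto simp: test_function_def)
  have cont: "continuous_on UNIV \<phi>"
    using \<phi> by (auto simp: test_function_def dest!: spec[of _ 0])
  obtain B where "0 < B" and B: "\<And>x. norm (\<phi> x) \<le> B"
    using bounded_compact_support[OF K(1) cont K(2)] by metis
  have "integrable lebesgue (\<lambda>x. indicator K x * h x)"
    using h K(1) by (auto simp: locally_integrable_def set_integrable_def)
  moreover have "\<phi> \<in> borel_measurable lebesgue"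
    using cont by (auto intro!: measurable_completion borel_measurable_continuous_onI)
  ultimately have "integrable lebesgue (\<lambda>x. indicator K x * h x * \<phi> x)"
    by (intro Bochner_Integration.integrable_bound[where
          f="\<lambda>x. B * (indicator K x * h x)" and g="\<lambda>x. indicator K x * h x * \<phi> x"])
       (use B \<open>0 < B\<close> in \<open>auto simp: abs_mult mult.commute[of B] intro!: AE_I2 mult_left_mono\<close>)
  moreover have "indicator K x * h x * \<phi> x = h x * \<phi> x" for x
    using K(2)[of x] by (auto simp: indicator_def)
  ultimately show ?thesis by simp
qed

text \<open>Both fields give the same integral against every test function, so the fundamental lemma
  applies to each component of their difference.\<close>

lemma weak_gradient_unique_AE:
  assumes "is_weak_gradient UNIV u g" "is_weak_gradient UNIV u g'"
  shows "AE x in lebesgue. g x = g' x"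
proof -
  have loc: "locally_integrable UNIV g" "locally_integrable UNIV g'"
    using assms by (auto simp: is_weak_gradient_def)
  have "AE x in lebesgue. g x \<bullet> e - g' x \<bullet> e = 0" if e: "e \<in> Basis" for e
  proof (rule AE_eq_0_if_test_integrals_0)
    show "locally_integrable UNIV (\<lambda>x. g x \<bullet> e - g' x \<bullet> e)"
      using loc[THEN locally_integrable_inner_left, of e]
      by (auto simp: locally_integrable_def set_integrable_def right_diff_distrib)
    fix \<phi> :: "'a \<Rightarrow> real" assume \<phi>: "test_function UNIV \<phi>"
    have "(LINT x|lebesgue. u x * frechet_derivative \<phi> (at x) e) = - (LINT x|lebesgue. (f x \<bullet> e) * \<phi> x)"
      if "is_weak_gradient UNIV u f" for f
      using that \<phi> e unfolding is_weak_gradient_def lebesgue_on_UNIV_eq by blast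
    from this[OF assms(1)] this[OF assms(2)]
    have "(LINT x|lebesgue. (g x \<bullet> e) * \<phi> x) = (LINT x|lebesgue. (g' x \<bullet> e) * \<phi> x)"
      by simp
    then show "(LINT x|lebesgue. (g x \<bullet> e - g' x \<bullet> e) * \<phi> x) = 0"
      using loc[THEN locally_integrable_inner_left, THEN integrable_times_test_function, OF \<phi>]
      by (simp add: left_diff_distrib)
  qed
  then have "AE x in lebesgue. \<forall>e\<in>Basis. g x \<bullet> e - g' x \<bullet> e = 0"
    by (intro AE_finite_allI) auto
  then show ?thesis
    by eventually_elim (auto intro: euclidean_eqI)
qed

lemma gradient_seminorm_C1c:
  assumes u: "C1c_with_gradient u G" and p: "p \<noteq> \<infinity>"
  shows "gradient_seminorm UNIV p u = Lp_norm UNIV p (\<lambda>x. norm (G x))"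
proof -
  note weak = C1c_is_weak_gradient[OF u]
  have "is_weak_gradient UNIV u (weak_gradient UNIV u)"
    unfolding weak_gradient_def by (rule someI[of "is_weak_gradient UNIV u", OF weak])
  from weak_gradient_unique_AE[OF this weak]
  have "(\<integral>\<^sup>+x. ennreal (\<bar>norm (weak_gradient UNIV u x)\<bar> powr real_of_ereal p) \<partial>lebesgue) =
      (\<integral>\<^sup>+x. ennreal (\<bar>norm (G x)\<bar> powr real_of_ereal p) \<partial>lebesgue)"
    by (intro nn_integral_cong_AE) auto
  then show ?thesis
    using weak p by (auto simp: gradient_seminorm_def Lp_norm_def lebesgue_on_UNIV_eq)
qed

section \<open>Scaling of the norms\<close>

lemma ennreal_pow_mono: "0 \<le> a \<Longrightarrow> x \<le> y \<Longrightarrow> ennreal_pow x a \<le> ennreal_pow y a"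
  by (auto simp: ennreal_pow_def top_unique less_top intro!: ennreal_leI powr_mono2 enn2real_mono)

lemma ennreal_pow_inverse: "0 < a \<Longrightarrow> ennreal_pow (ennreal_pow x a) (1 / a) = x"
  by (auto simp: ennreal_pow_def powr_powr less_top)

lemma ennreal_pow_mult:
  assumes "0 < c" "0 < a"
  shows "ennreal_pow (ennreal c * x) a = ennreal (c powr a) * ennreal_pow x a"
proof (cases "x = top")
  case True
  then show ?thesis using assms by (simp add: ennreal_pow_def ennreal_mult_top)
next
  case False
  then have "ennreal c * x \<noteq> top" by (simp add: ennreal_mult_eq_top_iff)
  with False show ?thesis
    using assms by (simp add: ennreal_pow_def enn2real_mult powr_mult ennreal_mult)
qed

lemma ennreal_pow_less_top_iff: "ennreal_pow x a < top \<longleftrightarrow> x < top"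
  by (auto simp: ennreal_pow_def less_top)

lemma ennreal_pow_pos_iff: "0 < ennreal_pow x a \<longleftrightarrow> 0 < x"
  by (cases x) (auto simp: ennreal_pow_def)

text \<open>Change of variables. It is used on the space itself and on its square, where the
  dimension is 2N.\<close>

lemma nn_integral_lebesgue_scale:
  fixes f :: "'a::euclidean_space \<Rightarrow> ennreal"
  assumes "f \<in> borel_measurable borel" "0 < l"
  shows "(\<integral>\<^sup>+x. f (x /\<^sub>R l) \<partial>lebesgue) = ennreal (l ^ DIM('a)) * (\<integral>\<^sup>+x. f x \<partial>lebesgue)"
proof -
  have [measurable]: "f \<in> borel_measurable borel" by fact
  have "(\<integral>\<^sup>+x. f (x /\<^sub>R l) \<partial>lborel) =
      (\<integral>\<^sup>+x. f (x /\<^sub>R l) \<partial>density (distr lborel borel (\<lambda>x. 0 + l *\<^sub>R x)) (\<lambda>_. \<bar>l\<bar> ^ DIM('a)))"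
    using lborel_affine[of l "0::'a"] assms(2) by simp
  also have "\<dots> = (\<integral>\<^sup>+x. ennreal (l ^ DIM('a)) * f x \<partial>lborel)"
    using assms(2) by (simp add: nn_integral_density nn_integral_distr)
  finally show ?thesis
    by (simp add: nn_integral_completion nn_integral_cmult)
qed

text \<open>The factor \<open>k\<close> is there for gradients: that of a dilated function carries
  an additional \<open>inverse l\<close>.\<close>

lemma Lp_norm_scale:
  fixes v :: "'a::euclidean_space \<Rightarrow> real"
  assumes v: "continuous_on UNIV v" and pos: "0 < k" "0 < l" "0 < P"
  shows "Lp_norm UNIV (ereal P) (\<lambda>x. k * v (x /\<^sub>R l)) =
    ennreal (k * l powr (real DIM('a) / P)) * Lp_norm UNIV (ereal P) v"
proof -
  have [measurable]: "v \<in> borel_measurable borel"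
    using v by (rule borel_measurable_continuous_onI)
  have "(\<integral>\<^sup>+x. ennreal (\<bar>k * v (x /\<^sub>R l)\<bar> powr P) \<partial>lebesgue) =
      (\<integral>\<^sup>+x. (\<lambda>x. ennreal (k powr P) * ennreal (\<bar>v x\<bar> powr P)) (x /\<^sub>R l) \<partial>lebesgue)"
    using pos by (simp add: abs_mult powr_mult ennreal_mult)
  also have "\<dots> = ennreal (l ^ DIM('a)) *
      (\<integral>\<^sup>+x. ennreal (k powr P) * ennreal (\<bar>v x\<bar> powr P) \<partial>lebesgue)"
    by (rule nn_integral_lebesgue_scale) (use pos in measurable)
  also have "\<dots> = ennreal (l ^ DIM('a) * k powr P) * (\<integral>\<^sup>+x. ennreal (\<bar>v x\<bar> powr P) \<partial>lebesgue)"
    using pos by (simp add: nn_integral_completion nn_integral_cmult ennreal_mult mult.assoc)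
  finally have "Lp_norm UNIV (ereal P) (\<lambda>x. k * v (x /\<^sub>R l)) =
      ennreal ((l ^ DIM('a) * k powr P) powr (1 / P)) * Lp_norm UNIV (ereal P) v"
    using pos by (simp add: Lp_norm_def lebesgue_on_UNIV_eq ennreal_pow_mult)
  also have "(l ^ DIM('a) * k powr P) powr (1 / P) = k * l powr (real DIM('a) / P)"
    using pos by (simp add: powr_mult powr_powr mult.commute flip: powr_realpow)
  finally show ?thesis .
qed

lemma Lp_norm_finite:
  fixes v :: "'a::euclidean_space \<Rightarrow> real"
  assumes v: "continuous_on UNIV v" and K: "compact K" "\<And>x. x \<notin> K \<Longrightarrow> v x = 0" and "0 < P"
  shows "Lp_norm UNIV (ereal P) v < top"
proof -
  have "continuous_on UNIV (\<lambda>x. \<bar>v x\<bar> powr P)"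
    using v \<open>0 < P\<close> by (intro continuous_on_powr' continuous_intros) auto
  then have "integrable lborel (\<lambda>x. \<bar>v x\<bar> powr P)"
    by (rule integrable_compact_support[OF K(1)]) (use K(2) \<open>0 < P\<close> in simp)
  then have "(\<integral>\<^sup>+x. ennreal (\<bar>v x\<bar> powr P) \<partial>lborel) < top"
    by (simp add: nn_integral_eq_integral)
  then show ?thesis
    by (simp add: Lp_norm_def ennreal_pow_less_top_iff lebesgue_on_UNIV_eq nn_integral_completion)
qed

text \<open>If the integral were 0, the zero set of \<open>v\<close> would be closed and of full
  measure, hence the whole space.\<close>

lemma Lp_norm_pos:
  fixes v :: "'a::euclidean_space \<Rightarrow> real"
  assumes v: "continuous_on UNIV v" and "v x0 \<noteq> 0" and "0 < P"
  shows "0 < Lp_norm UNIV (ereal P) v"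
proof -
  have [measurable]: "v \<in> borel_measurable lebesgue"
    using v by (auto intro!: measurable_completion borel_measurable_continuous_onI)
  have "(\<integral>\<^sup>+x. ennreal (\<bar>v x\<bar> powr P) \<partial>lebesgue) \<noteq> 0"
  proof
    assume "(\<integral>\<^sup>+x. ennreal (\<bar>v x\<bar> powr P) \<partial>lebesgue) = 0"
    then have "AE x in lebesgue. ennreal (\<bar>v x\<bar> powr P) = 0"
      by (subst (asm) nn_integral_0_iff_AE) auto
    then have "AE x in lebesgue. x \<in> {x. v x = 0}"
      by eventually_elim (auto simp: ennreal_eq_0_iff dest: order_antisym[OF _ powr_ge_zero])
    moreover have "closed {x. v x = 0}"
      using v by (intro closed_Collect_eq continuous_intros)
    ultimately show False
      using mem_closed_if_AE_lebesgue[of "{x. v x = 0}" x0] assms(2) by simp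
  qed
  then have "0 < (\<integral>\<^sup>+x. ennreal (\<bar>v x\<bar> powr P) \<partial>lebesgue)"
    by (simp add: zero_less_iff_neq_zero)
  then show ?thesis
    by (simp add: Lp_norm_def ennreal_pow_pos_iff lebesgue_on_UNIV_eq)
qed

section \<open>The Gagliardo seminorm under dilation\<close>

abbreviation gagliardo_integrand :: "real \<Rightarrow> real \<Rightarrow> ('a::euclidean_space \<Rightarrow> real) \<Rightarrow> 'a \<times> 'a \<Rightarrow> real"
  where "gagliardo_integrand s P u z \<equiv>
    \<bar>u (fst z) - u (snd z)\<bar> powr P / norm (fst z - snd z) powr (real DIM('a) + s * P)"

lemma gagliardo_seminorm_UNIV:
  fixes u :: "'a::euclidean_space \<Rightarrow> real"
  shows "gagliardo_seminorm UNIV s P u =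
    ennreal_pow (ennreal (gagliardo_const DIM('a) s P) *
      (\<integral>\<^sup>+z. ennreal (gagliardo_integrand s P u z) \<partial>lebesgue)) (1 / P)"
  by (simp add: gagliardo_seminorm_def lebesgue_on_UNIV_eq case_prod_beta)

lemma borel_measurable_gagliardo_integrand:
  assumes "continuous_on UNIV u"
  shows "gagliardo_integrand s P u \<in> borel_measurable borel"
proof -
  have [measurable]: "u \<in> borel_measurable borel"
    using assms by (rule borel_measurable_continuous_onI)
  show ?thesis
    unfolding borel_prod[symmetric] by measurable
qed

text \<open>Both arguments of Gamma are positive: P + N - 2 \<ge> 0 and P s > 0 for the numerator, 1
  - s > 0 for the denominator.\<close>

lemma gagliardo_const_pos:
  assumes "0 < N" "0 < s" "s < 1" "1 \<le> P"
  shows "0 < gagliardo_const N s P"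
proof -
  have "0 < P * s" using assms by simp
  then have "0 < P * s + P + real N - 2" using assms(1,4) by linarith
  then show ?thesis
    using assms by (auto simp: gagliardo_const_def intro!: divide_pos_pos mult_pos_pos Gamma_real_pos)
qed

text \<open>The kernel contributes the power -(N + s P) of \<open>l\<close> and the change of
  variables in dimension 2N the power 2N; the P-th root of the product has exponent N / P -
  s.\<close>

lemma gagliardo_seminorm_scale:
  fixes u :: "'a::euclidean_space \<Rightarrow> real"
  assumes u: "continuous_on UNIV u" and l: "0 < l" and P: "0 < P"
  shows "gagliardo_seminorm UNIV s P (\<lambda>x. u (x /\<^sub>R l)) =
    ennreal (l powr (real DIM('a) / P - s)) * gagliardo_seminorm UNIV s P u"
proof -
  let ?N = "real DIM('a)"
  have "gagliardo_integrand s P (\<lambda>x. u (x /\<^sub>R l)) z =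
      l powr - (?N + s * P) * gagliardo_integrand s P u (z /\<^sub>R l)" for z
  proof -
    have "norm (fst z - snd z) = l * norm (fst (z /\<^sub>R l) - snd (z /\<^sub>R l))"
      using l by (simp flip: scaleR_diff_right)
    then have "norm (fst z - snd z) powr (?N + s * P) =
        l powr (?N + s * P) * norm (fst (z /\<^sub>R l) - snd (z /\<^sub>R l)) powr (?N + s * P)"
      using l by (simp only: powr_mult norm_ge_zero less_imp_le)
    moreover have "a / (b * c) = inverse b * (a / c)" for a b c :: real
      by (simp add: divide_inverse mult_ac)
    ultimately show ?thesis
      by (simp only: fst_scaleR snd_scaleR powr_minus)
  qed
  then have "(\<integral>\<^sup>+z. ennreal (gagliardo_integrand s P (\<lambda>x. u (x /\<^sub>R l)) z) \<partial>lebesgue) =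
      (\<integral>\<^sup>+z. (\<lambda>z. ennreal (l powr - (?N + s * P)) * ennreal (gagliardo_integrand s P u z)) (z /\<^sub>R l)
        \<partial>lebesgue)"
    by (simp only: ennreal_mult powr_ge_zero divide_nonneg_nonneg)
  also have "\<dots> = ennreal (l ^ DIM('a \<times> 'a)) *
      (\<integral>\<^sup>+z. ennreal (l powr - (?N + s * P)) * ennreal (gagliardo_integrand s P u z) \<partial>lebesgue)"
    by (rule nn_integral_lebesgue_scale)
       (use borel_measurable_gagliardo_integrand[OF u] l in \<open>auto intro!: borel_measurable_times_ennreal\<close>)
  also have "\<dots> = ennreal (l ^ DIM('a \<times> 'a)) * (ennreal (l powr - (?N + s * P)) *
      (\<integral>\<^sup>+z. ennreal (gagliardo_integrand s P u z) \<partial>lebesgue))"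
    using borel_measurable_gagliardo_integrand[OF u]
    by (subst nn_integral_cmult) (auto intro!: measurable_completion)
  also have "\<dots> = ennreal (l powr (?N - s * P)) * (\<integral>\<^sup>+z. ennreal (gagliardo_integrand s P u z) \<partial>lebesgue)"
  proof -
    have "l ^ DIM('a \<times> 'a) * l powr - (?N + s * P) = l powr (?N - s * P)"
      using l by (simp flip: powr_realpow powr_add)
    then show ?thesis
      using l by (simp flip: mult.assoc ennreal_mult)
  qed
  finally have "gagliardo_seminorm UNIV s P (\<lambda>x. u (x /\<^sub>R l)) =
      ennreal_pow (ennreal (l powr (?N - s * P)) * (ennreal (gagliardo_const DIM('a) s P) *
        (\<integral>\<^sup>+z. ennreal (gagliardo_integrand s P u z) \<partial>lebesgue))) (1 / P)"
    by (simp add: gagliardo_seminorm_UNIV mult.left_commute)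
  also have "\<dots> = ennreal ((l powr (?N - s * P)) powr (1 / P)) * gagliardo_seminorm UNIV s P u"
    using l P by (simp add: gagliardo_seminorm_UNIV ennreal_pow_mult)
  also have "(l powr (?N - s * P)) powr (1 / P) = l powr (?N / P - s)"
    using P by (simp add: powr_powr diff_divide_distrib)
  finally show ?thesis .
qed

lemma gagliardo_seminorm_pos:
  fixes u :: "'a::euclidean_space \<Rightarrow> real"
  assumes u: "continuous_on UNIV u" and "u x0 \<noteq> u y0" and s: "0 < s" "s < 1" "1 \<le> P"
  shows "0 < gagliardo_seminorm UNIV s P u"
proof -
  have "(\<integral>\<^sup>+z. ennreal (gagliardo_integrand s P u z) \<partial>lebesgue) \<noteq> 0"
  proof
    assume "(\<integral>\<^sup>+z. ennreal (gagliardo_integrand s P u z) \<partial>lebesgue) = 0"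
    then have "AE z in lebesgue. ennreal (gagliardo_integrand s P u z) = 0"
      using borel_measurable_gagliardo_integrand[OF u]
      by (subst (asm) nn_integral_0_iff_AE) (auto intro!: measurable_completion)
    then have "AE z in lebesgue. z \<in> {z. u (fst z) = u (snd z)}"
    proof eventually_elim
      case (elim z)
      then have "gagliardo_integrand s P u z \<le> 0"
        by (simp only: ennreal_eq_0_iff)
      then have "gagliardo_integrand s P u z = 0"
        by (meson order_antisym divide_nonneg_nonneg powr_ge_zero)
      \<comment> \<open>The quotient is 0 if its numerator or its denominator is; in the latter case
        the point lies on the diagonal, where the two values agree anyway.\<close>
      then show ?case by auto
    qed
    moreover have "closed {z. u (fst z) = u (snd z)}"
      by (intro closed_Collect_eq continuous_on_compose2[OF u] continuous_intros) auto
    ultimately show False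
      using mem_closed_if_AE_lebesgue[of "{z. u (fst z) = u (snd z)}" "(x0, y0)"] assms(2) by simp
  qed
  then have "0 < (\<integral>\<^sup>+z. ennreal (gagliardo_integrand s P u z) \<partial>lebesgue)"
    by (simp only: zero_less_iff_neq_zero not_False_eq_True)
  then show ?thesis
    using gagliardo_const_pos[OF _ s, of "DIM('a)"]
    by (simp add: gagliardo_seminorm_UNIV ennreal_pow_pos_iff ennreal_zero_less_mult_iff)
qed

section \<open>Finiteness of the Gagliardo seminorm\<close>

text \<open>Fubini: while one point runs through the ball of radius \<open>R\<close>, the other is
  confined to a ball of radius \<open>r\<close> around it. Either point may be the one in the fixed
  ball, whence the factor 2.\<close>

lemma emeasure_strip_le:
  fixes R :: real
  assumes "0 \<le> R"
  shows "\<exists>C\<ge>0. \<forall>r\<ge>0.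
    emeasure lborel {z::'a::euclidean_space \<times> 'a. (norm (fst z) \<le> R \<or> norm (snd z) \<le> R) \<and>
      norm (fst z - snd z) \<le> r} \<le> ennreal (C * r ^ DIM('a))"
proof -
  define v where "v = unit_ball_vol (real DIM('a))"
  have v: "0 \<le> v" "emeasure lborel (cball x r :: 'a set) = ennreal (v * r ^ DIM('a))"
    if "0 \<le> r" for x :: 'a and r
    using that by (simp_all add: v_def emeasure_cball)
  have bound: "emeasure lborel {z::'a \<times> 'a. (norm (fst z) \<le> R \<or> norm (snd z) \<le> R) \<and>
      norm (fst z - snd z) \<le> r} \<le> ennreal ((2 * (v * R ^ DIM('a)) * v) * r ^ DIM('a))"
    if r: "0 \<le> r" for r
  proof -
    let ?S = "{z::'a \<times> 'a. norm (fst z) \<le> R \<and> norm (fst z - snd z) \<le> r}"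
    let ?T = "{z::'a \<times> 'a. norm (snd z) \<le> R \<and> norm (fst z - snd z) \<le> r}"
    have "closed ?S" "closed ?T"
      by (intro closed_Collect_conj closed_Collect_le continuous_intros)+
    then have sets: "?S \<in> sets (lborel \<Otimes>\<^sub>M lborel)" "?T \<in> sets (lborel \<Otimes>\<^sub>M lborel)"
      by (simp_all only: lborel_prod sets_lborel borel_closed)
    have slice: "Pair x -` ?S = (if x \<in> cball 0 R then cball x r else {})"
      "(\<lambda>y. (y, x)) -` ?T = (if x \<in> cball 0 R then cball x r else {})" for x
      by (auto simp: dist_norm norm_minus_commute)
    have meas: "emeasure lborel (if x \<in> cball 0 R then cball x r else {} :: 'a set) =
        ennreal (v * r ^ DIM('a)) * indicator (cball 0 R) x" for x
      using r by (auto simp: v)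
    have int: "(\<integral>\<^sup>+x. ennreal (v * r ^ DIM('a)) * indicator (cball (0::'a) R) x \<partial>lborel) =
        ennreal ((v * R ^ DIM('a)) * v * r ^ DIM('a))"
      using r assms v(1)[OF r]
      by (subst nn_integral_cmult_indicator) (simp_all add: v mult_ac flip: ennreal_mult)
    have "emeasure (lborel \<Otimes>\<^sub>M lborel) ?S = ennreal ((v * R ^ DIM('a)) * v * r ^ DIM('a))"
      using sets(1) by (simp only: lborel.emeasure_pair_measure_alt slice meas int)
    moreover have "emeasure (lborel \<Otimes>\<^sub>M lborel) ?T = ennreal ((v * R ^ DIM('a)) * v * r ^ DIM('a))"
      using sets(2) by (simp only: lborel_pair.emeasure_pair_measure_alt2 slice meas int)
    ultimately have "emeasure lborel (?S \<union> ?T) \<le>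
        ennreal ((v * R ^ DIM('a)) * v * r ^ DIM('a)) + ennreal ((v * R ^ DIM('a)) * v * r ^ DIM('a))"
      using emeasure_subadditive[OF sets] by (simp add: lborel_prod)
    also have "\<dots> = ennreal ((2 * (v * R ^ DIM('a)) * v) * r ^ DIM('a))"
      using r assms v(1)[OF r] by (simp flip: ennreal_plus)
    also have "?S \<union> ?T = {z. (norm (fst z) \<le> R \<or> norm (snd z) \<le> R) \<and> norm (fst z - snd z) \<le> r}"
      by auto
    finally show ?thesis .
  qed
  show ?thesis
    by (intro exI[of _ "2 * (v * R ^ DIM('a)) * v"] conjI allI impI bound) (use assms v(1)[of 0] in auto)
qed

text \<open>Integrating term by term and bounding the volumes of the strips leaves a geometric
  series. The radii may grow or shrink with \<open>k\<close>; both occur below.\<close>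

lemma nn_integral_strips_finite:
  fixes a r :: "nat \<Rightarrow> real" and R D \<rho> :: real
  assumes "0 \<le> R" "\<And>k. 0 \<le> a k" "\<And>k. 0 \<le> r k"
    and geo: "\<And>k. a k * r k ^ DIM('a::euclidean_space) \<le> D * \<rho> ^ k" and \<rho>: "0 \<le> \<rho>" "\<rho> < 1"
  shows "(\<integral>\<^sup>+z. (\<Sum>k. ennreal (a k) * indicator {z::'a \<times> 'a. (norm (fst z) \<le> R \<or> norm (snd z) \<le> R) \<and>
      norm (fst z - snd z) \<le> r k} z) \<partial>lborel) < top"
proof -
  let ?A = "\<lambda>k. {z::'a \<times> 'a. (norm (fst z) \<le> R \<or> norm (snd z) \<le> R) \<and> norm (fst z - snd z) \<le> r k}"
  obtain C where C: "0 \<le> C" "\<And>r. 0 \<le> r \<Longrightarrow>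
    emeasure lborel {z::'a \<times> 'a. (norm (fst z) \<le> R \<or> norm (snd z) \<le> R) \<and>
      norm (fst z - snd z) \<le> r} \<le> ennreal (C * r ^ DIM('a))"
    using emeasure_strip_le[OF assms(1), where 'a='a] by blast
  have "closed (?A k)" for k
    by (intro closed_Collect_conj closed_Collect_disj closed_Collect_le continuous_intros)
  then have [measurable]: "?A k \<in> sets borel" for k by simp
  have "(\<integral>\<^sup>+z. (\<Sum>k. ennreal (a k) * indicator (?A k) z) \<partial>lborel) =
      (\<Sum>k. ennreal (a k) * emeasure lborel (?A k))"
    by (subst nn_integral_suminf) (auto simp: nn_integral_cmult_indicator)
  also have "\<dots> \<le> (\<Sum>k. ennreal (C * D * \<rho> ^ k))"
  proof (intro suminf_le summableI)
    fix k
    have "ennreal (a k) * emeasure lborel (?A k) \<le> ennreal (a k) * ennreal (C * r k ^ DIM('a))"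
      by (intro mult_left_mono C assms(3)) simp
    also have "\<dots> = ennreal (C * (a k * r k ^ DIM('a)))"
      using assms(2,3) C(1) by (simp add: mult_ac flip: ennreal_mult)
    also have "\<dots> \<le> ennreal (C * D * \<rho> ^ k)"
      using mult_left_mono[OF geo C(1)] by (intro ennreal_leI) (simp add: mult.assoc)
    finally show "ennreal (a k) * emeasure lborel (?A k) \<le> ennreal (C * D * \<rho> ^ k)" .
  qed
  also have "\<dots> = ennreal (\<Sum>k. C * D * \<rho> ^ k)"
  proof (rule suminf_ennreal2)
    show "0 \<le> C * D * \<rho> ^ k" for k
    proof -
      \<comment> \<open>The case \<open>k = 0\<close> of \<open>geo\<close> bounds \<open>D\<close>
        from below by a product of nonnegative numbers.\<close>
      have "0 \<le> D"
        using order_trans[OF mult_nonneg_nonneg geo[of 0]] assms(2,3) by simp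
      then show ?thesis using C \<rho> by simp
    qed
    show "summable (\<lambda>k. C * D * \<rho> ^ k)"
      using \<rho> by (intro summable_mult summable_geometric) simp
  qed
  also have "\<dots> < top" by simp
  finally show ?thesis .
qed

text \<open>Applied to distances of at least 1 and, through \<open>1 / d\<close>, to smaller
  ones.\<close>

lemma dyadic_shell:
  assumes "1 \<le> (d::real)"
  obtains k :: nat where "2 powr real k \<le> d" "d \<le> 2 powr (real k + 1)"
proof -
  have log: "0 \<le> log 2 d" using assms by simp
  define k where "k = nat \<lfloor>log 2 d\<rfloor>"
  have "real k \<le> log 2 d" "log 2 d \<le> real k + 1"
    using log by (auto simp: k_def)
  then show thesis
    using assms by (intro that) (auto simp: le_log_iff log_le_iff)
qed

text \<open>Dyadic decomposition in \<open>\<bar>x - y\<bar>\<close>: far from the diagonal the integrand is controlled by the bound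
  of \<open>u\<close>, near the diagonal by its Lipschitz constant.\<close>

lemma gagliardo_seminorm_finite:
  fixes u :: "'a::euclidean_space \<Rightarrow> real"
  assumes u: "C1c_with_gradient u G" and s: "0 < s" "s < 1" and P: "1 \<le> P"
  shows "gagliardo_seminorm UNIV s P u < top"
proof -
  let ?N = "real DIM('a)"
  define q where "q = ?N + s * P"
  have q: "0 < q" using s P by (simp add: q_def add_pos_pos)
  obtain K where K: "compact K" "\<And>x. x \<notin> K \<Longrightarrow> u x = 0"
    using C1c_with_gradient_ex_support[OF u] by metis
  obtain R where R: "\<And>x. x \<in> K \<Longrightarrow> norm x \<le> R" "0 \<le> R"
    using compact_imp_bounded[OF K(1)] unfolding bounded_pos by (meson less_imp_le)
  obtain M where M: "0 < M" "\<And>x. norm (u x) \<le> M"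
    using bounded_compact_support[OF K(1) C1c_with_gradient_continuous(1)[OF u] K(2)] by metis
  obtain L where L: "0 < L" "\<And>x y. \<bar>u x - u y\<bar> \<le> L * norm (x - y)"
    using C1c_with_gradient_lipschitz[OF u] by metis
  let ?A = "\<lambda>r. {z::'a \<times> 'a. (norm (fst z) \<le> R \<or> norm (snd z) \<le> R) \<and> norm (fst z - snd z) \<le> r}"
  \<comment> \<open>\<open>a k\<close> bounds the integrand for distances between 2^k and 2^(k+1) =
    \<open>r k\<close>, where the numerator is at most (2M)^P. \<open>b k\<close> does so between
    2^(-k-1) and 2^(-k) = \<open>t k\<close>, where it is at most (L \<open>t k\<close>)^P.\<close>
  define a r b t where "a k = (2 * M) powr P * 2 powr (- (real k * q))"
    and "r k = 2 powr (real k + 1)"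
    and "b k = L powr P * 2 powr (- (real k * P)) * 2 powr ((real k + 1) * q)"
    and "t k = 2 powr (- real k)" for k :: nat
  have powr_pow: "(2 powr x) ^ n = 2 powr (x * real n)" for x :: real and n
    by (simp add: powr_powr flip: powr_realpow)
  \<comment> \<open>The volume factor cancels the N in the exponent \<open>q\<close>; what is left
    has ratio 2^(-s P), below 1 because s > 0.\<close>
  have far: "(\<integral>\<^sup>+z. (\<Sum>k. ennreal (a k) * indicator (?A (r k)) z) \<partial>lborel) < top"
  proof (rule nn_integral_strips_finite[OF R(2)])
    show "a k * r k ^ DIM('a) \<le> ((2 * M) powr P * 2 powr ?N) * (2 powr (- (s * P))) ^ k" for k
      unfolding a_def r_def powr_pow q_def
      by (simp add: mult.assoc flip: powr_add) (simp add: algebra_simps)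
    show "2 powr (- (s * P)) < 1" using s P by (simp add: powr_less_one)
  qed (auto simp: a_def r_def)
  \<comment> \<open>Here the Lipschitz bound contributes 2^(-k P), so the ratio is 2^(-(1 - s) P),
    below 1 because s < 1.\<close>
  have near: "(\<integral>\<^sup>+z. (\<Sum>k. ennreal (b k) * indicator (?A (t k)) z) \<partial>lborel) < top"
  proof (rule nn_integral_strips_finite[OF R(2)])
    show "b k * t k ^ DIM('a) \<le> (L powr P * 2 powr q) * (2 powr (- ((1 - s) * P))) ^ k" for k
      unfolding b_def t_def powr_pow q_def
      by (simp add: mult.assoc flip: powr_add) (simp add: algebra_simps)
    show "2 powr (- ((1 - s) * P)) < 1" using s P by (simp add: powr_less_one)
  qed (auto simp: b_def t_def)
  have le: "ennreal (gagliardo_integrand s P u z) \<le>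
      (\<Sum>k. ennreal (a k) * indicator (?A (r k)) z) + (\<Sum>k. ennreal (b k) * indicator (?A (t k)) z)" for z
  proof (cases "u (fst z) = u (snd z)")
    case False
    define d where "d = norm (fst z - snd z)"
    have "0 < d" using False by (auto simp: d_def)
    \<comment> \<open>Different values force only one of the two points into the support, which is
      why the strips constrain either point.\<close>
    have "fst z \<in> K \<or> snd z \<in> K" using False K(2) by metis
    then have z: "norm (fst z) \<le> R \<or> norm (snd z) \<le> R" using R(1) by blast
    have term_le: "f k \<le> (\<Sum>k. f k)" for f :: "nat \<Rightarrow> ennreal" and k
      using sum_le_suminf[OF summableI, of "{k}" f] by simp
    have I: "gagliardo_integrand s P u z = \<bar>u (fst z) - u (snd z)\<bar> powr P / d powr q"
      by (simp add: d_def q_def)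
    show ?thesis
    proof (cases "1 \<le> d")
      case True
      obtain k where k: "2 powr real k \<le> d" "d \<le> r k"
        using dyadic_shell[OF True] unfolding r_def by metis
      have "\<bar>u (fst z) - u (snd z)\<bar> \<le> 2 * M"
        using M(2)[of "fst z"] M(2)[of "snd z"] by auto
      then have "\<bar>u (fst z) - u (snd z)\<bar> powr P \<le> (2 * M) powr P"
        using P by (intro powr_mono2) auto
      moreover have "(2 powr real k) powr q \<le> d powr q"
        using k q by (intro powr_mono2) auto
      ultimately have "gagliardo_integrand s P u z \<le> (2 * M) powr P / (2 powr real k) powr q"
        unfolding I by (intro frac_le) auto
      also have "\<dots> = a k" by (simp add: a_def powr_powr powr_minus divide_inverse)
      finally have "ennreal (gagliardo_integrand s P u z) \<le> ennreal (a k) * indicator (?A (r k)) z"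
        using z k by (simp add: d_def ennreal_leI)
      also note term_le[of "\<lambda>k. ennreal (a k) * indicator (?A (r k)) z" k]
      finally show ?thesis by (rule order_trans) simp
    next
      case False
      then have "1 \<le> 1 / d" using \<open>0 < d\<close> by simp
      then obtain k :: nat where "2 powr real k \<le> 1 / d" "1 / d \<le> 2 powr (real k + 1)"
        by (rule dyadic_shell)
      then have k: "d \<le> t k" "2 powr (- (real k + 1)) \<le> d"
        using \<open>0 < d\<close> unfolding t_def powr_minus by (simp_all add: field_simps)
      have "\<bar>u (fst z) - u (snd z)\<bar> \<le> L * d"
        using L(2) by (simp add: d_def)
      also have "\<dots> \<le> L * t k" using k(1) L(1) by simp
      finally have "\<bar>u (fst z) - u (snd z)\<bar> powr P \<le> (L * t k) powr P"
        using P by (intro powr_mono2) auto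
      moreover have "(2 powr (- (real k + 1))) powr q \<le> d powr q"
        using k q by (intro powr_mono2) auto
      ultimately have "gagliardo_integrand s P u z \<le> (L * t k) powr P / (2 powr (- (real k + 1))) powr q"
        unfolding I by (intro frac_le) auto
      also have "\<dots> = b k"
      proof -
        have "(2 powr (- (real k + 1))) powr q = inverse (2 powr ((real k + 1) * q))"
          by (simp only: powr_powr powr_minus[symmetric] mult_minus_left)
        moreover have "(L * t k) powr P = L powr P * 2 powr (- (real k * P))"
          using L(1) by (simp add: t_def powr_mult powr_powr)
        ultimately show ?thesis by (simp only: b_def divide_inverse inverse_inverse_eq)
      qed
      finally have "ennreal (gagliardo_integrand s P u z) \<le> ennreal (b k) * indicator (?A (t k)) z"
        using z k by (simp add: d_def ennreal_leI)
      also note term_le[of "\<lambda>k. ennreal (b k) * indicator (?A (t k)) z" k]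
      finally show ?thesis by (rule order_trans) simp
    qed
  qed (use P in simp)
  have meas: "(\<lambda>z. \<Sum>k. ennreal (c k) * indicator (?A (w k)) z) \<in> borel_measurable lborel" for c w
  proof -
    have "closed (?A x)" for x
      by (intro closed_Collect_conj closed_Collect_disj closed_Collect_le continuous_intros)
    then have [measurable]: "?A x \<in> sets borel" for x by simp
    show ?thesis by measurable
  qed
  have "(\<integral>\<^sup>+z. ennreal (gagliardo_integrand s P u z) \<partial>lebesgue) \<le>
      (\<integral>\<^sup>+z. (\<Sum>k. ennreal (a k) * indicator (?A (r k)) z) + (\<Sum>k. ennreal (b k) * indicator (?A (t k)) z)
        \<partial>lborel)"
    unfolding nn_integral_completion by (intro nn_integral_mono le)
  also have "\<dots> < top"
    using far near by (simp only: nn_integral_add meas) simp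
  finally show ?thesis
    by (simp add: gagliardo_seminorm_UNIV ennreal_pow_less_top_iff ennreal_mult_less_top)
qed

section \<open>Hoelder seminorms and the dilation argument\<close>

lemma holder_quotient_sup_ge:
  "x \<noteq> y \<Longrightarrow> ennreal (\<bar>v x - v y\<bar> / norm (x - y) powr s) \<le> holder_quotient_sup UNIV s v"
  unfolding holder_quotient_sup_def by (rule SUP_upper2[of "(x, y)"]) auto

lemma holder_seminorm_le: "holder_seminorm S s u \<le> holder_quotient_sup S s u"
  unfolding holder_seminorm_def by (rule INF_lower) simp

text \<open>A Hoelder bound for an a.e. equal \<open>v\<close> passes to \<open>u\<close> almost
  everywhere. By continuity the bound for \<open>u\<close> defines a closed set, and a closed set of
  full measure is everything. This is applied in one variable at a time.\<close>

lemma holder_quotient_sup_le_holder_seminorm: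
  fixes u :: "'a::euclidean_space \<Rightarrow> real"
  assumes u: "continuous_on UNIV u" and s: "0 < s"
  shows "holder_quotient_sup UNIV s u \<le> holder_seminorm UNIV s u"
  unfolding holder_seminorm_def
proof (intro INF_greatest)
  fix v assume "v \<in> {v. AE x in lebesgue_on UNIV. v x = u x}"
  then have v: "AE x in lebesgue. v x = u x"
    by (simp only: mem_Collect_eq lebesgue_on_UNIV_eq)
  show "holder_quotient_sup UNIV s u \<le> holder_quotient_sup UNIV s v"
  proof (cases "holder_quotient_sup UNIV s v")
    case (real q)
    have vq: "\<bar>v x - v y\<bar> \<le> q * norm (x - y) powr s" for x y
    proof (cases "x = y")
      case False
      then have "\<bar>v x - v y\<bar> / norm (x - y) powr s \<le> q"
        using holder_quotient_sup_ge[OF False, of v s] real by (simp add: ennreal_le_iff)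
      then show ?thesis using False by (simp add: divide_le_eq)
    qed simp
    have cont: "continuous_on UNIV (\<lambda>x. norm (x - y) powr s)" "continuous_on UNIV (\<lambda>x. norm (y - x) powr s)"
      for y :: 'a
      by (rule continuous_on_powr'; use s in \<open>auto intro!: continuous_intros\<close>)+
    \<comment> \<open>First variable: \<open>y\<close> is kept at a point where \<open>v\<close> and
      \<open>u\<close> agree.\<close>
    have uv: "\<bar>u x - u y\<bar> \<le> q * norm (x - y) powr s" if "v y = u y" for x y
    proof -
      have "AE x in lebesgue. x \<in> {x. \<bar>u x - u y\<bar> \<le> q * norm (x - y) powr s}"
        using v
      proof eventually_elim
        case (elim x)
        then show ?case using vq[of x y] that by simp
      qed
      moreover have "closed {x. \<bar>u x - u y\<bar> \<le> q * norm (x - y) powr s}"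
        by (intro closed_Collect_le continuous_intros cont u)
      ultimately show ?thesis
        using mem_closed_if_AE_lebesgue by blast
    qed
    \<comment> \<open>Second variable: such points \<open>y\<close> have full measure, so closedness
      now covers all \<open>y\<close>.\<close>
    have "AE y in lebesgue. y \<in> {y. \<bar>u x - u y\<bar> \<le> q * norm (x - y) powr s}" for x
      using v
    proof eventually_elim
      case (elim y)
      then show ?case using uv[of y x] by simp
    qed
    moreover have "closed {y. \<bar>u x - u y\<bar> \<le> q * norm (x - y) powr s}" for x
      by (intro closed_Collect_le continuous_intros cont u)
    ultimately have uq: "\<bar>u x - u y\<bar> \<le> q * norm (x - y) powr s" for x y
      using mem_closed_if_AE_lebesgue by blast
    have "ennreal (\<bar>u x - u y\<bar> / norm (x - y) powr s) \<le> ennreal q" if "x \<noteq> y" for x y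
      using uq[of x y] that by (intro ennreal_leI) (simp add: divide_le_eq)
    then have "holder_quotient_sup UNIV s u \<le> ennreal q"
      unfolding holder_quotient_sup_def by (intro SUP_least) auto
    then show ?thesis using real by simp
  qed simp
qed

text \<open>At distance d \<le> 1 the Lipschitz bound is used with d \<le> d^s, beyond that the sup
  bound with d^s \<ge> 1; hence the constant \<open>L + 2 * M\<close>.\<close>

lemma holder_quotient_sup_C1c:
  assumes u: "C1c_with_gradient u G" and s: "0 < s" "s \<le> 1"
  obtains B where "0 < B" "\<And>l. 0 < l \<Longrightarrow> holder_quotient_sup UNIV s (\<lambda>x. u (x /\<^sub>R l)) \<le> ennreal (B * l powr (- s))"
proof -
  obtain K where K: "compact K" "\<And>x. x \<notin> K \<Longrightarrow> u x = 0"
    using C1c_with_gradient_ex_support[OF u] by metis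
  obtain M where M: "0 < M" "\<And>x. norm (u x) \<le> M"
    using bounded_compact_support[OF K(1) C1c_with_gradient_continuous(1)[OF u] K(2)] by metis
  obtain L where L: "0 < L" "\<And>x y. \<bar>u x - u y\<bar> \<le> L * norm (x - y)"
    using C1c_with_gradient_lipschitz[OF u] by metis
  have holder: "\<bar>u x - u y\<bar> \<le> (L + 2 * M) * norm (x - y) powr s" for x y
  proof (cases "norm (x - y) \<le> 1")
    case True
    then have "norm (x - y) \<le> norm (x - y) powr s"
      using s powr_mono'[of s 1 "norm (x - y)"] by simp
    then have "L * norm (x - y) \<le> (L + 2 * M) * norm (x - y) powr s"
      using L M by (intro mult_mono) auto
    then show ?thesis using L(2)[of x y] by linarith
  next
    case False
    then have "1 \<le> norm (x - y) powr s" using s by (simp add: ge_one_powr_ge_zero)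
    then have "(2 * M) * 1 \<le> (L + 2 * M) * norm (x - y) powr s"
      using L M by (intro mult_mono) auto
    moreover have "\<bar>u x - u y\<bar> \<le> 2 * M"
      using M(2)[of x] M(2)[of y] by auto
    ultimately show ?thesis by linarith
  qed
  have "holder_quotient_sup UNIV s (\<lambda>x. u (x /\<^sub>R l)) \<le> ennreal ((L + 2 * M) * l powr (- s))"
    if l: "0 < l" for l
    unfolding holder_quotient_sup_def
  proof (intro SUP_least, clarify, intro ennreal_leI)
    fix x y :: 'a assume "x \<noteq> y"
    have "norm (x /\<^sub>R l - y /\<^sub>R l) = inverse l * norm (x - y)"
      using l by (simp flip: scaleR_diff_right)
    then have "norm (x /\<^sub>R l - y /\<^sub>R l) powr s = l powr (- s) * norm (x - y) powr s"
      using l by (simp only: powr_mult inverse_powr powr_minus)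
    then have "\<bar>u (x /\<^sub>R l) - u (y /\<^sub>R l)\<bar> \<le> ((L + 2 * M) * l powr (- s)) * norm (x - y) powr s"
      using holder[of "x /\<^sub>R l" "y /\<^sub>R l"] by (simp only: mult.assoc)
    then show "\<bar>u (x /\<^sub>R l) - u (y /\<^sub>R l)\<bar> / norm (x - y) powr s \<le> (L + 2 * M) * l powr (- s)"
      using \<open>x \<noteq> y\<close> by (simp add: divide_le_eq)
  qed
  then show thesis
    using L M by (intro that[of "L + 2 * M"]) auto
qed

text \<open>Here and below the exponent \<open>N / p\<close> is 0 for \<open>p = \<infinity>\<close>, because \<open>real_of_ereal \<infinity> = 0\<close> and \<open>x / 0 = 0\<close>.\<close>

lemma Lp_norm_scale_le:
  fixes u :: "'a::euclidean_space \<Rightarrow> real"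
  assumes u: "C1c_with_gradient u G" and p: "1 \<le> p"
  obtains A where "0 \<le> A" "\<And>l. 0 < l \<Longrightarrow>
    Lp_norm UNIV p (\<lambda>x. u (x /\<^sub>R l)) \<le> ennreal (A * l powr (real DIM('a) / real_of_ereal p))"
proof -
  note cont = C1c_with_gradient_continuous(1)[OF u]
  obtain K where K: "compact K" "\<And>x. x \<notin> K \<Longrightarrow> u x = 0"
    using C1c_with_gradient_ex_support[OF u] by metis
  show thesis
  proof (cases p)
    case (real P)
    then have P: "1 \<le> P" using p by simp
    then have fin: "Lp_norm UNIV p u < top"
      using Lp_norm_finite[OF cont K] real by simp
    show thesis
    proof (rule that[of "enn2real (Lp_norm UNIV p u)"])
      fix l :: real assume l: "0 < l"
      have "Lp_norm UNIV p (\<lambda>x. u (x /\<^sub>R l)) = ennreal (l powr (real DIM('a) / P)) * Lp_norm UNIV p u"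
        using Lp_norm_scale[OF cont zero_less_one l, of P] P real by simp
      also have "\<dots> = ennreal (enn2real (Lp_norm UNIV p u) * l powr (real DIM('a) / real_of_ereal p))"
        using fin real by (simp add: ennreal_mult mult.commute)
      finally show "Lp_norm UNIV p (\<lambda>x. u (x /\<^sub>R l)) \<le>
          ennreal (enn2real (Lp_norm UNIV p u) * l powr (real DIM('a) / real_of_ereal p))" by simp
    qed simp
  next
    case PInf
    obtain M where M: "0 < M" "\<And>x. norm (u x) \<le> M"
      using bounded_compact_support[OF K(1) cont K(2)] by metis
    show thesis
    proof (rule that[of M])
      fix l :: real assume l: "0 < l"
      have "continuous_on UNIV (\<lambda>x. u (x /\<^sub>R l))"
        by (rule C1c_with_gradient_continuous[OF C1c_with_gradient_scale[OF u l]])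
      then have [measurable]: "(\<lambda>x. u (x /\<^sub>R l)) \<in> borel_measurable lebesgue"
        by (auto intro!: measurable_completion borel_measurable_continuous_onI)
      have "esssup lebesgue (\<lambda>x. ennreal \<bar>u (x /\<^sub>R l)\<bar>) \<le> ennreal M"
        using M(2) by (intro esssup_I) (auto intro!: AE_I2 ennreal_leI)
      then show "Lp_norm UNIV p (\<lambda>x. u (x /\<^sub>R l)) \<le> ennreal (M * l powr (real DIM('a) / real_of_ereal p))"
        using PInf l by (simp add: Lp_norm_def lebesgue_on_UNIV_eq)
    qed (use M in simp)
  qed (use p in simp)
qed

section \<open>Dilation bounds for the seminorms of all orders and exponents\<close>

lemma Wsp_seminorm_scale:
  fixes u :: "'a::euclidean_space \<Rightarrow> real"
  assumes u: "C1c_with_gradient u G" and s: "0 < s" "s \<le> 1" and P: "1 \<le> P" and l: "0 < l"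
  shows "Wsp_seminorm UNIV s (ereal P) (\<lambda>x. u (x /\<^sub>R l)) =
    ennreal (l powr (real DIM('a) / P - s)) * Wsp_seminorm UNIV s (ereal P) u"
proof (cases "s = 1")
  case True
  have cont: "continuous_on UNIV (\<lambda>x. norm (G x))"
    by (intro continuous_intros C1c_with_gradient_continuous(2)[OF u])
  have "gradient_seminorm UNIV (ereal P) (\<lambda>x. u (x /\<^sub>R l)) =
      Lp_norm UNIV (ereal P) (\<lambda>x. inverse l * norm (G (x /\<^sub>R l)))"
    using gradient_seminorm_C1c[OF C1c_with_gradient_scale[OF u l], of "ereal P"] l by simp
  also have "\<dots> = ennreal (inverse l * l powr (real DIM('a) / P)) * gradient_seminorm UNIV (ereal P) u"
    using Lp_norm_scale[OF cont _ l, of "inverse l" P] P l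
    by (simp add: gradient_seminorm_C1c[OF u])
  also have "inverse l * l powr (real DIM('a) / P) = l powr (real DIM('a) / P - 1)"
    using l by (simp add: powr_diff divide_inverse mult.commute)
  finally show ?thesis using True by (simp add: Wsp_seminorm_def)
next
  case False
  then show ?thesis
    using gagliardo_seminorm_scale[OF C1c_with_gradient_continuous(1)[OF u] l, of P s] s P
    by (simp add: Wsp_seminorm_def)
qed

lemma Wsp_seminorm_finite:
  fixes u :: "'a::euclidean_space \<Rightarrow> real"
  assumes u: "C1c_with_gradient u G" and s: "0 < s" "s \<le> 1" and P: "1 \<le> P"
  shows "Wsp_seminorm UNIV s (ereal P) u < top"
proof (cases "s = 1")
  case True
  obtain K where K: "compact K" "\<And>x. x \<notin> K \<Longrightarrow> G x = 0"
    using C1c_with_gradient_ex_support[OF u] by metis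
  have "continuous_on UNIV (\<lambda>x. norm (G x))"
    by (intro continuous_intros C1c_with_gradient_continuous(2)[OF u])
  from Lp_norm_finite[OF this K(1), of P] show ?thesis
    using True K P by (simp add: Wsp_seminorm_def gradient_seminorm_C1c[OF u])
next
  case False
  then show ?thesis
    using gagliardo_seminorm_finite[OF u, of s P] s P by (simp add: Wsp_seminorm_def)
qed

lemma Wsp_seminorm_pos:
  fixes u :: "'a::euclidean_space \<Rightarrow> real"
  assumes u: "C1c_with_gradient u G" and "u x0 \<noteq> u y0" and s: "0 < s" "s \<le> 1" and P: "1 \<le> P"
  shows "0 < Wsp_seminorm UNIV s (ereal P) u"
proof (cases "s = 1")
  case True
  have "\<exists>x. G x \<noteq> 0"
  proof (rule ccontr)
    assume "\<nexists>x. G x \<noteq> 0"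
    then have "(u has_derivative (\<lambda>_. 0)) (at x within UNIV)" for x
      using u by (auto simp: C1c_with_gradient_def)
    then have "u x0 = u y0"
      using has_derivative_zero_unique[of UNIV u x0 y0] by auto
    with assms(2) show False by simp
  qed
  then obtain x where "norm (G x) \<noteq> 0" by auto
  moreover have "continuous_on UNIV (\<lambda>x. norm (G x))"
    by (intro continuous_intros C1c_with_gradient_continuous(2)[OF u])
  ultimately have "0 < Lp_norm UNIV (ereal P) (\<lambda>x. norm (G x))"
    using P by (intro Lp_norm_pos) auto
  then show ?thesis
    using True by (simp add: Wsp_seminorm_def gradient_seminorm_C1c[OF u])
next
  case False
  then show ?thesis
    using gagliardo_seminorm_pos[OF C1c_with_gradient_continuous(1)[OF u] assms(2), of s P] s P
    by (simp add: Wsp_seminorm_def)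
qed

text \<open>For finite exponents this is the scaling identity, at infinity only an estimate; the
  source space needs no more than an upper bound.\<close>

lemma Wsp_seminorm_scale_le:
  fixes u :: "'a::euclidean_space \<Rightarrow> real"
  assumes u: "C1c_with_gradient u G" and s: "0 < s" "s \<le> 1" and p: "1 \<le> p"
  obtains B where "0 \<le> B" "\<And>l. 0 < l \<Longrightarrow>
    Wsp_seminorm UNIV s p (\<lambda>x. u (x /\<^sub>R l)) \<le> ennreal (B * l powr (real DIM('a) / real_of_ereal p - s))"
proof (cases p)
  case (real P)
  then have P: "1 \<le> P" using p by simp
  show thesis
  proof (rule that[of "enn2real (Wsp_seminorm UNIV s p u)"])
    show "Wsp_seminorm UNIV s p (\<lambda>x. u (x /\<^sub>R l)) \<le>
        ennreal (enn2real (Wsp_seminorm UNIV s p u) * l powr (real DIM('a) / real_of_ereal p - s))"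
      if "0 < l" for l
      using Wsp_seminorm_scale[OF u s P that] Wsp_seminorm_finite[OF u s P] real
      by (simp add: ennreal_mult mult.commute)
  qed simp
next
  case PInf
  obtain B where B: "0 < B" "\<And>l. 0 < l \<Longrightarrow>
      holder_quotient_sup UNIV s (\<lambda>x. u (x /\<^sub>R l)) \<le> ennreal (B * l powr (- s))"
    using holder_quotient_sup_C1c[OF u s] by metis
  show thesis
  proof (rule that[of B])
    show "Wsp_seminorm UNIV s p (\<lambda>x. u (x /\<^sub>R l)) \<le> ennreal (B * l powr (real DIM('a) / real_of_ereal p - s))"
      if "0 < l" for l
      using order_trans[OF holder_seminorm_le B(2)[OF that]] PInf s by (simp add: Wsp_seminorm_def)
  qed (use B in simp)
qed (use p in simp)

lemma Wsp_seminorm_scale_ge: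
  fixes u :: "'a::euclidean_space \<Rightarrow> real"
  assumes u: "C1c_with_gradient u G" and xy: "u x0 \<noteq> u y0" and s: "0 < s" "s \<le> 1" and p: "1 \<le> p"
  obtains X where "0 < X" "\<And>l. 0 < l \<Longrightarrow>
    ennreal (l powr (real DIM('a) / real_of_ereal p - s)) * X \<le> Wsp_seminorm UNIV s p (\<lambda>x. u (x /\<^sub>R l))"
proof (cases p)
  case (real P)
  then have P: "1 \<le> P" using p by simp
  show thesis
    by (rule that[of "Wsp_seminorm UNIV s p u"])
       (use Wsp_seminorm_pos[OF u xy s P] Wsp_seminorm_scale[OF u s P] real in auto)
next
  case PInf
  \<comment> \<open>The Hoelder quotient at a single pair of points; at the dilated pair it is
    multiplied by \<open>l powr (- s)\<close>.\<close>
  define c where "c = \<bar>u x0 - u y0\<bar> / norm (x0 - y0) powr s"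
  have "x0 \<noteq> y0" using xy by auto
  show thesis
  proof (rule that[of "ennreal c"])
    show "0 < ennreal c" using xy \<open>x0 \<noteq> y0\<close> by (simp add: c_def)
    fix l :: real assume l: "0 < l"
    have "l powr (- s) * c = \<bar>u ((l *\<^sub>R x0) /\<^sub>R l) - u ((l *\<^sub>R y0) /\<^sub>R l)\<bar> / norm (l *\<^sub>R x0 - l *\<^sub>R y0) powr s"
    proof -
      have "norm (l *\<^sub>R x0 - l *\<^sub>R y0) = l * norm (x0 - y0)"
        using l by (simp flip: scaleR_diff_right)
      then show ?thesis
        using l by (simp add: c_def powr_mult powr_minus divide_inverse)
    qed
    also have "ennreal \<dots> \<le> holder_quotient_sup UNIV s (\<lambda>x. u (x /\<^sub>R l))"
      using \<open>x0 \<noteq> y0\<close> l holder_quotient_sup_ge[of "l *\<^sub>R x0" "l *\<^sub>R y0" "\<lambda>x. u (x /\<^sub>R l)" s] by simp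
    also have "\<dots> \<le> holder_seminorm UNIV s (\<lambda>x. u (x /\<^sub>R l))"
      by (rule holder_quotient_sup_le_holder_seminorm[OF
            C1c_with_gradient_continuous(1)[OF C1c_with_gradient_scale[OF u l]] s(1)])
    finally show "ennreal (l powr (real DIM('a) / real_of_ereal p - s)) * ennreal c \<le>
        Wsp_seminorm UNIV s p (\<lambda>x. u (x /\<^sub>R l))"
      using PInf s by (simp add: Wsp_seminorm_def c_def flip: ennreal_mult)
  qed
qed (use p in simp)

section \<open>The norm compared with its two parts\<close>

lemma Lp_norm_le_Wsp_norm: "1 \<le> p \<Longrightarrow> Lp_norm S p u \<le> Wsp_norm S s p u"
proof (cases p)
  case (real P)
  assume "1 \<le> p"
  then have "Lp_norm S p u = ennreal_pow (ennreal_pow (Lp_norm S p u) P) (1 / P)"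
    using real by (simp add: ennreal_pow_inverse)
  also have "\<dots> \<le> ennreal_pow (ennreal_pow (Wsp_seminorm S s p u) P + ennreal_pow (Lp_norm S p u) P) (1 / P)"
    using \<open>1 \<le> p\<close> real by (intro ennreal_pow_mono) auto
  finally show ?thesis using real by (simp add: Wsp_norm_def)
qed (auto simp: Wsp_norm_def)

lemma Wsp_seminorm_le_Wsp_norm: "1 \<le> p \<Longrightarrow> Wsp_seminorm S s p u \<le> Wsp_norm S s p u"
proof (cases p)
  case (real P)
  assume "1 \<le> p"
  then have "Wsp_seminorm S s p u = ennreal_pow (ennreal_pow (Wsp_seminorm S s p u) P) (1 / P)"
    using real by (simp add: ennreal_pow_inverse)
  also have "\<dots> \<le> ennreal_pow (ennreal_pow (Wsp_seminorm S s p u) P + ennreal_pow (Lp_norm S p u) P) (1 / P)"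
    using \<open>1 \<le> p\<close> real by (intro ennreal_pow_mono) auto
  finally show ?thesis using real by (auto simp: Wsp_norm_def Wsp_seminorm_def)
qed (auto simp: Wsp_norm_def Wsp_seminorm_def)

text \<open>Both parts are at most their sum \<open>?Z\<close>, so for finite P the norm is at most
  2^(1/P) \<open>?Z\<close>; the factor 2 serves all exponents at once.\<close>

lemma Wsp_norm_le:
  assumes "1 \<le> p"
  shows "Wsp_norm S s p u \<le> 2 * (Lp_norm S p u + Wsp_seminorm S s p u)"
proof -
  let ?Z = "Lp_norm S p u + Wsp_seminorm S s p u"
  have le: "x \<le> 2 * y" if "x \<le> y" for x y :: ennreal
    using order_trans[OF that, of "2 * y"] by (simp add: mult_2 add_increasing2)
  consider "s = 0" | "s \<noteq> 0" "p = \<infinity>" | P where "s \<noteq> 0" "p = ereal P" "1 \<le> P"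
    using assms by (cases p) auto
  then show ?thesis
  proof cases
    case 3
    have "ennreal_pow (Wsp_seminorm S s p u) P + ennreal_pow (Lp_norm S p u) P \<le>
        ennreal_pow ?Z P + ennreal_pow ?Z P"
      using 3 by (intro add_mono ennreal_pow_mono) auto
    also have "\<dots> = ennreal 2 * ennreal_pow ?Z P"
      by (simp add: mult_2)
    finally have "Wsp_norm S s p u \<le> ennreal_pow (ennreal 2 * ennreal_pow ?Z P) (1 / P)"
      using 3 by (simp only: Wsp_norm_def real_of_ereal.simps ereal.distinct if_False) (auto intro: ennreal_pow_mono)
    also have "\<dots> = ennreal (2 powr (1 / P)) * ?Z"
      using 3 by (subst ennreal_pow_mult) (simp_all add: ennreal_pow_inverse)
    also have "\<dots> \<le> ennreal 2 * ?Z"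
      using 3 powr_mono[of "1 / P" 1 2] by (intro mult_right_mono ennreal_leI) auto
    finally show ?thesis by simp
  next
    case 1
    then show ?thesis by (intro le) (simp add: Wsp_norm_def)
  next
    case 2
    then show ?thesis by (intro le) (simp add: Wsp_norm_def)
  qed
qed

section \<open>The two limits of the dilation argument\<close>

text \<open>Common end of both limits: \<open>m\<close> is the dilation factor when that is large,
  its inverse when it is small. \<open>X\<close> may be infinite and is replaced by a positive real
  below it.\<close>

lemma ennreal_powr_unbounded:
  assumes "0 < X" "0 < \<gamma>" "\<And>m. 1 \<le> m \<Longrightarrow> ennreal (m powr \<gamma>) * X \<le> ennreal K"
  shows False
proof -
  obtain x where x: "0 < x" "ennreal x \<le> X"
    using assms(1) by (cases X) (auto intro: that[of 1] simp: top_greatest)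
  \<comment> \<open>Chosen so that \<open>m powr \<gamma> * x\<close> equals
    \<open>\<bar>K\<bar> + 1 + x\<close>; the last summand 1 ensures
    \<open>1 \<le> m\<close>.\<close>
  define m where "m = ((\<bar>K\<bar> + 1) / x + 1) powr (1 / \<gamma>)"
  have ge: "1 \<le> (\<bar>K\<bar> + 1) / x + 1" using x by simp
  then have "m powr \<gamma> = (\<bar>K\<bar> + 1) / x + 1"
    using assms(2) by (simp add: m_def powr_powr)
  then have "m powr \<gamma> * x = \<bar>K\<bar> + 1 + x"
    using x by (simp add: field_simps)
  moreover have "ennreal (m powr \<gamma> * x) \<le> ennreal \<bar>K\<bar>"
  proof -
    have "1 \<le> m" using ge assms(2) by (simp add: m_def ge_one_powr_ge_zero)
    have "ennreal (m powr \<gamma> * x) = ennreal (m powr \<gamma>) * ennreal x"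
      using x by (simp add: ennreal_mult)
    also have "\<dots> \<le> ennreal (m powr \<gamma>) * X" by (intro mult_left_mono x) simp
    also have "\<dots> \<le> ennreal K" using assms(3) \<open>1 \<le> m\<close> .
    also have "\<dots> \<le> ennreal \<bar>K\<bar>" by (intro ennreal_leI) simp
    finally show ?thesis .
  qed
  ultimately show False using x by (simp add: ennreal_le_iff)
qed

text \<open>The zero \<open>y0\<close> is recorded because positivity of a seminorm requires two
  different values.\<close>

lemma ex_nontrivial_C1c:
  obtains u :: "'a::euclidean_space \<Rightarrow> real" and G x0 y0
  where "C1c_with_gradient u G" "u x0 \<noteq> 0" "u y0 = 0"
proof -
  let ?u = "box_bump (- One) One 1 :: 'a \<Rightarrow> real"
  have "?u 0 \<noteq> 0"
    using box_bump_pos[of 1 0 "- One" "One :: 'a"] by (simp add: mem_box)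
  moreover have "?u One = 0"
    using SOME_Basis by (intro box_bump_eq_0) (auto simp: mem_box)
  moreover have "test_function UNIV ?u" by (rule test_function_box_bump) simp
  ultimately show thesis using that test_function_imp_C1c by blast
qed

text \<open>Dilations stay in the source space, so the embedding transfers the upper bounds for both
  parts of the source norm to the target norm.\<close>

lemma embedding_imp_scaling_bound:
  fixes u :: "'a::euclidean_space \<Rightarrow> real"
  assumes u: "C1c_with_gradient u G" and s: "0 < s" "s \<le> 1" and p: "1 \<le> p"
    and emb: "Wsp_continuously_embedded (UNIV :: 'a set) s p s' p'"
  defines "a \<equiv> real DIM('a) / real_of_ereal p"
  obtains K where "0 \<le> K" "\<And>l. 0 < l \<Longrightarrow>
    Wsp_norm UNIV s' p' (\<lambda>x. u (x /\<^sub>R l)) \<le> ennreal (K * (l powr a + l powr (a - s)))"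
proof -
  obtain A where A: "0 \<le> A" "\<And>l. 0 < l \<Longrightarrow> Lp_norm UNIV p (\<lambda>x. u (x /\<^sub>R l)) \<le> ennreal (A * l powr a)"
    using Lp_norm_scale_le[OF u p] unfolding a_def by metis
  obtain B where B: "0 \<le> B" "\<And>l. 0 < l \<Longrightarrow>
      Wsp_seminorm UNIV s p (\<lambda>x. u (x /\<^sub>R l)) \<le> ennreal (B * l powr (a - s))"
    using Wsp_seminorm_scale_le[OF u s p] unfolding a_def by metis
  obtain C where C: "\<And>v. v \<in> Wsp (UNIV :: 'a set) s p \<Longrightarrow> Wsp_norm UNIV s' p' v \<le> ennreal C * Wsp_norm UNIV s p v"
    using emb by (auto simp: Wsp_continuously_embedded_def)
  \<comment> \<open>The embedding constant \<open>C\<close> is an arbitrary real, hence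
    \<open>\<bar>C\<bar>\<close>; the 2 comes from \<open>Wsp_norm_le\<close>, and
    \<open>A + B\<close> dominates both coefficients.\<close>
  have "Wsp_norm UNIV s' p' (\<lambda>x. u (x /\<^sub>R l)) \<le> ennreal ((\<bar>C\<bar> * (2 * (A + B))) * (l powr a + l powr (a - s)))"
    if l: "0 < l" for l
  proof -
    let ?v = "\<lambda>x. u (x /\<^sub>R l)"
    have "?v \<in> borel_measurable lebesgue"
      using C1c_with_gradient_continuous(1)[OF C1c_with_gradient_scale[OF u l]]
      by (auto intro!: measurable_completion borel_measurable_continuous_onI)
    then have "?v \<in> Wsp UNIV s p"
      using A(2)[OF l] B(2)[OF l] by (auto simp: Wsp_def lebesgue_on_UNIV_eq intro: le_less_trans)
    then have "Wsp_norm UNIV s' p' ?v \<le> ennreal C * Wsp_norm UNIV s p ?v" by (rule C)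
    also have "\<dots> \<le> ennreal \<bar>C\<bar> * (2 * (ennreal (A * l powr a) + ennreal (B * l powr (a - s))))"
      by (intro mult_mono order_trans[OF Wsp_norm_le[OF p]] mult_left_mono add_mono A(2) B(2) l ennreal_leI) auto
    also have "\<dots> = ennreal (\<bar>C\<bar> * (2 * (A * l powr a + B * l powr (a - s))))"
      using A B by (simp add: ennreal_mult)
    also have "\<dots> \<le> ennreal (\<bar>C\<bar> * (2 * ((A + B) * (l powr a + l powr (a - s)))))"
      using A(1) B(1) by (intro ennreal_leI mult_left_mono) (auto simp: algebra_simps)
    finally show ?thesis by (simp only: mult.assoc)
  qed
  then show thesis using A B by (intro that[of "\<bar>C\<bar> * (2 * (A + B))"]) auto
qed

text \<open>Only the Lebesgue part of the target norm enters, so \<open>s'\<close> is arbitrary. For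
  \<open>l \<ge> 1\<close> the seminorm term of the source is absorbed by its Lebesgue term.\<close>

lemma not_embedded_if_decay:
  assumes s: "0 < s" "s \<le> 1" and p: "1 \<le> p" "1 \<le> p'" and "p' \<noteq> \<infinity>"
    and less: "real DIM('a) / real_of_ereal p < real DIM('a) / real_of_ereal p'"
  shows "\<not> Wsp_continuously_embedded (UNIV :: 'a::euclidean_space set) s p s' p'"
proof
  assume emb: "Wsp_continuously_embedded (UNIV :: 'a set) s p s' p'"
  obtain u :: "'a \<Rightarrow> real" and G x0 y0 where u: "C1c_with_gradient u G" "u x0 \<noteq> 0" "u y0 = 0"
    by (rule ex_nontrivial_C1c)
  define a a' where "a = real DIM('a) / real_of_ereal p" and "a' = real DIM('a) / real_of_ereal p'"
  obtain K where K: "0 \<le> K" "\<And>l. 0 < l \<Longrightarrow>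
      Wsp_norm UNIV s' p' (\<lambda>x. u (x /\<^sub>R l)) \<le> ennreal (K * (l powr a + l powr (a - s)))"
    using embedding_imp_scaling_bound[OF u(1) s p(1) emb] unfolding a_def by metis
  obtain P' where P': "p' = ereal P'" "1 \<le> P'"
    using p(2) \<open>p' \<noteq> \<infinity>\<close> by (cases p') auto
  note cont = C1c_with_gradient_continuous(1)[OF u(1)]
  show False
  proof (rule ennreal_powr_unbounded)
    show "0 < Lp_norm UNIV p' u"
      using Lp_norm_pos[OF cont u(2)] P' by simp
    show "0 < a' - a" using less by (simp add: a_def a'_def)
    fix l :: real assume l: "1 \<le> l"
    have "ennreal (l powr a) * (ennreal (l powr (a' - a)) * Lp_norm UNIV p' u) =
        ennreal (l powr a') * Lp_norm UNIV p' u"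
      using l by (simp flip: mult.assoc ennreal_mult powr_add)
    also have "\<dots> = Lp_norm UNIV p' (\<lambda>x. u (x /\<^sub>R l))"
      using Lp_norm_scale[OF cont zero_less_one, of l P'] l P' by (simp add: a'_def)
    also have "\<dots> \<le> Wsp_norm UNIV s' p' (\<lambda>x. u (x /\<^sub>R l))"
      by (rule Lp_norm_le_Wsp_norm[OF p(2)])
    also have "\<dots> \<le> ennreal (K * (l powr a + l powr (a - s)))"
      using K(2) l by simp
    also have "\<dots> \<le> ennreal (K * (l powr a + l powr a))"
      using K(1) s l by (intro ennreal_leI mult_left_mono add_left_mono powr_mono) auto
    also have "\<dots> = ennreal (l powr a) * ennreal (2 * K)"
      using K(1) by (simp flip: ennreal_mult)
    finally show "ennreal (l powr (a' - a)) * Lp_norm UNIV p' u \<le> ennreal (2 * K)"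
      using l by (simp add: ennreal_mult_le_mult_iff)
  qed
qed

text \<open>Now the seminorm part of the target is used, and for \<open>l \<le> 1\<close> it is the
  Lebesgue term of the source that is absorbed.\<close>

lemma not_embedded_if_rough:
  assumes s: "0 < s" "s \<le> 1" and s': "0 < s'" "s' \<le> 1" and p: "1 \<le> p" "1 \<le> p'"
    and less: "s - real DIM('a) / real_of_ereal p < s' - real DIM('a) / real_of_ereal p'"
  shows "\<not> Wsp_continuously_embedded (UNIV :: 'a::euclidean_space set) s p s' p'"
proof
  assume emb: "Wsp_continuously_embedded (UNIV :: 'a set) s p s' p'"
  obtain u :: "'a \<Rightarrow> real" and G x0 y0 where u: "C1c_with_gradient u G" "u x0 \<noteq> 0" "u y0 = 0"
    by (rule ex_nontrivial_C1c)
  define a a' where "a = real DIM('a) / real_of_ereal p" and "a' = real DIM('a) / real_of_ereal p'"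
  obtain K where K: "0 \<le> K" "\<And>l. 0 < l \<Longrightarrow>
      Wsp_norm UNIV s' p' (\<lambda>x. u (x /\<^sub>R l)) \<le> ennreal (K * (l powr a + l powr (a - s)))"
    using embedding_imp_scaling_bound[OF u(1) s p(1) emb] unfolding a_def by metis
  obtain X where X: "0 < X" "\<And>l. 0 < l \<Longrightarrow>
      ennreal (l powr (a' - s')) * X \<le> Wsp_seminorm UNIV s' p' (\<lambda>x. u (x /\<^sub>R l))"
    using Wsp_seminorm_scale_ge[OF u(1) _ s' p(2), of x0 y0] u(2,3) unfolding a'_def by metis
  show False
  proof (rule ennreal_powr_unbounded)
    show "0 < X" by (rule X)
    define d where "d = (s' - a') - (s - a)"
    show "0 < d" using less by (simp add: a_def a'_def d_def)
    fix m :: real assume m: "1 \<le> m"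
    define l where "l = inverse m"
    have l: "0 < l" "l \<le> 1" using m by (auto simp: l_def inverse_le_1_iff)
    have "m powr d = l powr (- d)"
      using m by (simp add: l_def powr_minus inverse_powr)
    then have "l powr (a - s) * m powr d = l powr (a' - s')"
      by (simp add: d_def flip: powr_add)
    then have "ennreal (l powr (a - s)) * (ennreal (m powr d) * X) = ennreal (l powr (a' - s')) * X"
      by (simp flip: mult.assoc ennreal_mult)
    also have "\<dots> \<le> Wsp_seminorm UNIV s' p' (\<lambda>x. u (x /\<^sub>R l))"
      by (rule X(2)[OF l(1)])
    also have "\<dots> \<le> Wsp_norm UNIV s' p' (\<lambda>x. u (x /\<^sub>R l))"
      by (rule Wsp_seminorm_le_Wsp_norm[OF p(2)])
    also have "\<dots> \<le> ennreal (K * (l powr a + l powr (a - s)))"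
      using K(2) l by simp
    also have "\<dots> \<le> ennreal (K * (l powr (a - s) + l powr (a - s)))"
      using K(1) s l by (intro ennreal_leI mult_left_mono add_right_mono powr_mono') auto
    also have "\<dots> = ennreal (l powr (a - s)) * ennreal (2 * K)"
      using K(1) by (simp flip: ennreal_mult)
    finally show "ennreal (m powr d) * X \<le> ennreal (2 * K)"
      using l by (simp add: ennreal_mult_le_mult_iff)
  qed
qed

theorem proposition2p14:
  fixes s s' :: real and p p' :: ereal
  assumes "0 < s" "s \<le> 1" "1 \<le> p"
    and "ereal s * p > ereal (real DIM('a))"
    and "0 \<le> s'" "s' \<le> 1" "1 \<le> p'"
    and "\<not> ((0 \<le> s' \<and> ereal s' \<le> ereal s - ereal (real DIM('a)) / p \<and>
             p \<le> p' \<and> p' \<le> \<infinity>) \<or>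
            (ereal s - ereal (real DIM('a)) / p < ereal s' \<and> s' \<le> s \<and>
             p \<le> p' \<and>
             p' \<le> ereal (real DIM('a)) * p / (ereal (real DIM('a)) - ereal (s - s') * p)))"
  shows "\<not> Wsp_continuously_embedded (UNIV :: 'a::euclidean_space set) s p s' p'"
proof -
  let ?N = "real DIM('a)"
  have N: "0 < ?N" by simp
  \<comment> \<open>The two disjuncts are what \<open>not_embedded_if_decay\<close> and
    \<open>not_embedded_if_rough\<close> refute; the first is p' < p in terms of
    reciprocals.\<close>
  have "(p' \<noteq> \<infinity> \<and> ?N / real_of_ereal p < ?N / real_of_ereal p') \<or>
      (0 < s' \<and> s - ?N / real_of_ereal p < s' - ?N / real_of_ereal p')"
  proof (cases p)
    case PInf
    show ?thesis
    proof (cases p')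
      case (real P')
      then show ?thesis using PInf N assms(7) by simp
    next
      case PInf
      \<comment> \<open>With both exponents infinite the first alternative reads 0 \<le> s' \<le> s,
        so its failure means s < s'.\<close>
      then show ?thesis using \<open>p = \<infinity>\<close> assms by auto
    qed (use assms(7) in simp)
  next
    case (real P)
    then have P: "1 \<le> P" "?N < s * P" using assms(3,4) by auto
    \<comment> \<open>Here s p > N enters: the threshold is positive, so an order above it is
      positive as well.\<close>
    then have gap: "0 < s - ?N / P" by (simp add: field_simps)
    show ?thesis
    proof (cases "p' < p")
      case True
      then obtain P' where "p' = ereal P'" "1 \<le> P'" "P' < P"
        using real assms(7) by (cases p') auto
      then show ?thesis using real N by (auto intro: divide_strict_left_mono)
    next
      case False
      then have "p \<le> p'" by simp
      \<comment> \<open>Otherwise the first alternative would hold, since p \<le> p'.\<close>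
      have s': "s - ?N / P < s'"
        using assms(8) \<open>p \<le> p'\<close> \<open>0 \<le> s'\<close> real P by auto
      have "s - ?N / P < s' - ?N / real_of_ereal p'"
      proof (cases p')
        case PInf
        then show ?thesis using s' by simp
      next
        case (real P')
        then have P': "P \<le> P'" using \<open>p \<le> p'\<close> \<open>p = ereal P\<close> by simp
        have "?N / P' \<le> ?N / P" using P' P N by (intro divide_left_mono) auto
        show ?thesis
        proof (cases "s' \<le> s")
          case False
          then show ?thesis using \<open>?N / P' \<le> ?N / P\<close> real by simp
        next
          case True
          \<comment> \<open>The denominator of the critical exponent N p / (N - (s - s') p). It is
            positive because s' > s - N / p, so clearing fractions in the violated bound on p' gives
            the scaling inequality.\<close>
          define D where "D = ?N - (s - s') * P"
          have "0 < D" using s' P by (simp add: D_def field_simps)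
          then have "?N * P / D < P'"
            using assms(8) \<open>p \<le> p'\<close> real \<open>p = ereal P\<close> True s' P by (auto simp: D_def)
          then have "?N * P < P' * D" using \<open>0 < D\<close> by (simp add: divide_less_eq)
          then have "?N / P' < D / P" using P P' by (simp add: field_simps)
          also have "D / P = ?N / P - (s - s')" using P by (simp add: D_def field_simps)
          finally show ?thesis using real by simp
        qed
      qed (use assms(7) in simp)
      then show ?thesis using real gap s' by auto
    qed
  qed (use assms(3) in simp)
  then show ?thesis
    using not_embedded_if_decay[OF assms(1-3,7), where 'a='a]
      not_embedded_if_rough[OF assms(1,2) _ assms(6,3,7), where 'a='a] by blast
qed

end
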